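(* Let $M=Ap$, where $p$ is a prime, $A$ is a square-free positive integer, $A\le 0.1p^{0.1}$, and $(A,p)=1$. Then $$S(R_M)=2f_A(0.5)\,p+O(A^3p^{0.95}),$$ with an absolute implied constant, where $f_A$ is the rational function defined in the context.
   Context: For a positive integer $n$ and $U\subseteq\mathbb{Z}_n$ with $|U|=k\ge2$, write $U=\{u_1<\dots<u_k\}\subseteq\{0,\dots,n-1\}$, $s_i=u_{i+1}-u_i$ ($i<k$), $s_k=u_1+n-u_k$, and $S(U)=\sum_i s_i^2$. $R_M=\{a^2:a\in\mathbb{Z}_M\}$. For the positive integer $A$, write $R_A=\{0=i_1<i_2<\dots<i_r\}\subseteq\{0,\dots,A-1\}$ with $r=|R_A|$, and let $s_1,\dots,s_r$ be the consecutive distances $s_j=i_{j+1}-i_j$ ($j<r$), $s_r=A-i_r$, with indices of $s$ taken modulo $r$. Define $Q(y)=1+y+\dots+y^{r-1}$ and $F(y)=\sum_{k=0}^{r}\beta_k y^k$ where $\beta_0=\beta_r=\sum_{i=1}^r s_i^2$ and $\beta_k=2\sum_{i=1}^r s_is_{i+k}$ for $0<k<r$. Then $f_A(y)=F(y)/Q(y)$. *)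

theory Defs
  imports Complex_Main "HOL-Computational_Algebra.Squarefree"
begin

text \<open>
  Residue classes modulo \<open>n\<close> are represented by their least non-negative representatives,
  so subsets of \<open>\<int>\<^sub>n\<close> are subsets of \<open>{..<n}\<close>.
\<close>

definition squares_mod :: "nat \<Rightarrow> nat set" where
  "squares_mod n = (\<lambda>a. a\<^sup>2 mod n) ` {..<n}"

text \<open>
  The gaps \<open>s\<^sub>1, \<dots>, s\<^sub>k\<close> of \<open>U\<close> are indexed from 0, i.e. \<open>s\<^sub>j = cyclic_gap n U (j - 1)\<close>, and the
  index is read modulo \<open>k = card U\<close>.  The last gap wraps around; for
  \<open>U = {u} \<subseteq> {..<n}\<close> it is the only one and equals \<open>n\<close>.
\<close>

definition cyclic_gap :: "nat \<Rightarrow> nat set \<Rightarrow> nat \<Rightarrow> nat" where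
  "cyclic_gap n U i =
     (let us = sorted_list_of_set U; k = card U; j = i mod k
      in if j + 1 < k then us ! (j + 1) - us ! j else us ! 0 + n - us ! j)"

definition gap_square_sum :: "nat \<Rightarrow> nat set \<Rightarrow> nat" where
  "gap_square_sum n U = (\<Sum>i<card U. (cyclic_gap n U i)\<^sup>2)"

definition beta_coeff :: "nat \<Rightarrow> nat \<Rightarrow> nat" where
  "beta_coeff A k =
     (let r = card (squares_mod A); s = cyclic_gap A (squares_mod A)
      in if k = 0 \<or> k = r then \<Sum>i<r. (s i)\<^sup>2 else 2 * (\<Sum>i<r. s i * s (i + k)))"

definition F_fun :: "nat \<Rightarrow> real \<Rightarrow> real" where
  "F_fun A y = (\<Sum>k\<le>card (squares_mod A). real (beta_coeff A k) * y ^ k)"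

definition Q_fun :: "nat \<Rightarrow> real \<Rightarrow> real" where
  "Q_fun A y = (\<Sum>k<card (squares_mod A). y ^ k)"

definition f_fun :: "nat \<Rightarrow> real \<Rightarrow> real" where
  "f_fun A y = F_fun A y / Q_fun A y"

end

theory Submission
  imports Defs "HOL-Computational_Algebra.Polynomial" "HOL-Number_Theory.Euler_Criterion"
    "HOL-Real_Asymp.Real_Asymp" "HOL-Library.FuncSet"
begin

text \<open>
  Let \<open>N\<^sub>h\<close> be the number of \<open>x\<close> modulo \<open>M\<close> such that none of \<open>x + 1, \<dots>, x + h\<close> is a square modulo \<open>M\<close>.
  A gap of length \<open>s\<close> contributes \<open>s - h\<close> to \<open>N\<^sub>h\<close> for each \<open>h < s\<close>, hence \<open>S(R\<^sub>M) = 2 \<Sum>\<^sub>h N\<^sub>h - M\<close>.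
  By the Chinese remainder theorem, \<open>N\<^sub>h\<close> counts for each \<open>a\<close> modulo \<open>A\<close> the runs of nonresidues modulo
  \<open>p\<close> at those shifts \<open>i \<le> h\<close> for which \<open>a + i\<close> is a square modulo \<open>A\<close>.  If there are \<open>c(a, h)\<close> such
  shifts, the Weil bound for Legendre symbol sums (proved here by Stepanov's method, with polynomials
  over the integers read modulo \<open>p\<close>) gives \<open>p / 2\<^sup>c\<^sup>(\<^sup>a\<^sup>,\<^sup>h\<^sup>) + O(h \<surd>p)\<close> runs, and the sum of these main
  terms over all \<open>a\<close> and \<open>h\<close> is a geometric series along the gaps of \<open>R\<^sub>A\<close> that evaluates to
  \<open>f\<^sub>A(1/2)\<close>.  This is used for \<open>h \<le> A T\<close> with \<open>T\<close> about \<open>2 ln p\<close>.  For larger \<open>h\<close> one has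
  \<open>N\<^sub>h \<le> N\<^sub>A\<^sub>T = O(A\<^sup>2 T \<surd>p)\<close>, and Burgess' dilation trick shows that \<open>N\<^sub>h = 0\<close> as soon as \<open>h\<close> exceeds
  about \<open>A T p\<^sup>0\<^sup>.\<^sup>4\<^sup>2\<close>.
\<close>

section \<open>Integer polynomials modulo a prime\<close>

hide_const (open) up_ring.monom up_ring.coeff module.smult

lemma prime_elem_const_int_poly: "prime p \<Longrightarrow> prime_elem [:int p:]"
  by (intro lift_prime_elem_poly) auto

lemma const_dvd_imp_dvd_poly: "[:c:] dvd f \<Longrightarrow> c dvd poly f x" for c :: int
  by (elim dvdE) simp

lemma const_dvd_pderiv: "[:c:] dvd f \<Longrightarrow> [:c:] dvd (pderiv ^^ i) f" for c :: int
proof (induction i)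
  case (Suc i)
  then obtain g where "(pderiv ^^ i) f = [:c:] * g" by blast
  then have "(pderiv ^^ Suc i) f = [:c:] * pderiv g" by (simp add: pderiv_smult)
  then show ?case by (metis dvd_triv_left)
qed simp

text \<open>Leibniz rule in which only two terms survive, one factor being linear. At
  \<open>i = 0\<close> the truncated \<open>i - 1\<close> is harmless because its coefficient is
  0.\<close>

lemma higher_pderiv_linear_mult:
  "(pderiv ^^ i) ([:- b, 1:] * g) =
     [:- b, 1:] * (pderiv ^^ i) g + of_nat i * (pderiv ^^ (i - 1)) g" for g :: "int poly"
proof (induction i)
  case (Suc i)
  show ?case
  proof (cases i)
    case 0
    then show ?thesis by (simp add: pderiv_mult pderiv_pCons del: mult_pCons_left)
  next
    case (Suc k)
    then show ?thesis
      using Suc.IH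
      by (simp add: pderiv_mult pderiv_add pderiv_pCons algebra_simps one_pCons[symmetric]
          del: mult_pCons_left)
  qed
qed simp

text \<open>Counts roots over the field with \<open>p\<close> elements, with multiplicities read off
  from derivatives. The induction splits off one factor \<open>X - b\<close> at a time, which lowers
  the multiplicity at \<open>b\<close> by one. Derivatives detect multiplicities only up to
  \<open>p\<close>, since the order of differentiation has to be invertible modulo \<open>p\<close>;
  hence the bound on \<open>\<mu>\<close>.\<close>

lemma sum_multiplicities_le_degree:
  fixes h :: "int poly" and p :: nat
  assumes p: "prime p" and S: "finite S" "S \<subseteq> {0..<int p}" and "\<not> [:int p:] dvd h"
    and "\<And>b. b \<in> S \<Longrightarrow> \<mu> b \<le> p"
    and "\<And>b i. b \<in> S \<Longrightarrow> i < \<mu> b \<Longrightarrow> int p dvd poly ((pderiv ^^ i) h) b"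
  shows "sum \<mu> S \<le> degree h"
  using assms(4-)
proof (induction "sum \<mu> S" arbitrary: \<mu> h)
  case (Suc n)
  then obtain b where b: "b \<in> S" "\<mu> b > 0"
    by (metis not_gr_zero sum.neutral nat.distinct(1))
  \<comment> \<open>The remainder \<open>poly h b\<close> is divisible by \<open>p\<close>, so
    modulo \<open>p\<close> the quotient \<open>g\<close> is exactly
    \<open>h / (X - b)\<close>.\<close>
  define g where "g = synthetic_div h b"
  have h: "h = [:- b, 1:] * g + [:poly h b:]"
    unfolding g_def by (rule synthetic_div_correct'[symmetric])
  have hb: "int p dvd poly h b"
    using Suc.prems(3)[of b 0] b by simp
  have g: "\<not> [:int p:] dvd g"
  proof
    assume "[:int p:] dvd g"
    then have "[:int p:] dvd [:- b, 1:] * g + [:poly h b:]"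
      using hb by (intro dvd_add dvd_mult) auto
    then show False using Suc.prems(1) h by simp
  qed
  have deg: "degree h = Suc (degree g)"
  proof -
    have "degree h > 0"
    proof (rule ccontr)
      assume "\<not> 0 < degree h"
      then obtain c where "h = [:c:]" by (auto elim: degree_eq_zeroE)
      then show False using hb Suc.prems(1) by auto
    qed
    then show ?thesis by (simp add: g_def degree_synthetic_div)
  qed
  define \<nu> where "\<nu> = \<mu>(b := \<mu> b - 1)"
  have sum_\<nu>: "sum \<mu> S = Suc (sum \<nu> S)"
    using b S by (simp add: \<nu>_def sum.remove[of S b])
  have der: "int p dvd (y - b) * poly ((pderiv ^^ i) g) y + int i * poly ((pderiv ^^ (i - 1)) g) y"
    if "y \<in> S" "i < \<mu> y" for y i
  proof -
    have "(pderiv ^^ i) h = ([:- b, 1:] * (pderiv ^^ i) g + of_nat i * (pderiv ^^ (i - 1)) g) +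
            (pderiv ^^ i) [:poly h b:]"
      by (subst h) (simp only: higher_pderiv_add higher_pderiv_linear_mult)
    moreover have "int p dvd poly ((pderiv ^^ i) [:poly h b:]) y"
      using hb by (intro const_dvd_imp_dvd_poly const_dvd_pderiv) auto
    moreover have "int p dvd poly ((pderiv ^^ i) h) y"
      using Suc.prems(3) that by blast
    ultimately have "int p dvd poly ([:- b, 1:] * (pderiv ^^ i) g + of_nat i * (pderiv ^^ (i - 1)) g) y"
      by (metis dvd_add_left_iff poly_add)
    then show ?thesis by (simp add: algebra_simps)
  qed
  have prime': "prime (int p)" using p by simp
  have "int p dvd poly ((pderiv ^^ i) g) y" if "y \<in> S" "i < \<nu> y" for y i
  proof (cases "y = b")
    case True
    then have i: "Suc i < \<mu> b" using that b by (auto simp: \<nu>_def)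
    then have "int p dvd int (Suc i) * poly ((pderiv ^^ i) g) b"
      using der[of b "Suc i"] b by simp
    \<comment> \<open>Here \<open>Suc i < \<mu> b \<le> p\<close>, so \<open>Suc i\<close> can be
      cancelled: at \<open>b\<close> itself the condition of order \<open>Suc i\<close> on
      \<open>h\<close> becomes the one of order \<open>i\<close> on \<open>g\<close>.\<close>
    moreover have "\<not> int p dvd int (Suc i)"
      using i Suc.prems(2)[of b] b by (meson int_dvd_int_iff nat_dvd_not_less not_less_eq_eq
        order_less_le_trans zero_less_Suc)
    ultimately show ?thesis using prime' True by (meson prime_dvd_multD)
  next
    case False
    \<comment> \<open>Distinct points of \<open>S\<close> are incongruent modulo \<open>p\<close>,
      so away from \<open>b\<close> the factor \<open>y - b\<close> is invertible, and the
      conditions pass from \<open>h\<close> to \<open>g\<close> by induction on the order.\<close>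
    have "\<bar>y - b\<bar> < int p"
      using subsetD[OF S(2) b(1)] subsetD[OF S(2) that(1)] by auto
    then have nd: "\<not> int p dvd y - b"
      using False dvd_imp_le_int[of "y - b" "int p"] by auto
    show ?thesis using that(2)
    proof (induction i)
      case 0
      then have "int p dvd (y - b) * poly g y"
        using der[of y 0] that(1) False by (auto simp: \<nu>_def)
      from prime_dvd_multD[OF prime' this] nd show ?case by simp
    next
      case (Suc i)
      then have "int p dvd (y - b) * poly ((pderiv ^^ Suc i) g) y + int (Suc i) * poly ((pderiv ^^ i) g) y"
        using der[of y "Suc i"] that(1) False by (auto simp: \<nu>_def)
      moreover have "int p dvd int (Suc i) * poly ((pderiv ^^ i) g) y"
        using Suc by simp
      ultimately have "int p dvd (y - b) * poly ((pderiv ^^ Suc i) g) y"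
        by (simp only: dvd_add_left_iff)
      then show ?case using prime' nd by (meson prime_dvd_multD)
    qed
  qed
  moreover have "\<nu> y \<le> p" if "y \<in> S" for y
    using Suc.prems(2)[OF that] by (auto simp: \<nu>_def)
  ultimately have "sum \<nu> S \<le> degree g"
    using Suc.hyps(1)[of \<nu> g] Suc.hyps(2) sum_\<nu> g by simp
  then show ?case using sum_\<nu> deg by simp
qed simp

section \<open>Stepanov's method\<close>

text \<open>What remains of the \<open>i\<close>-th derivative of \<open>f ^ n * k\<close> once
  \<open>f ^ (n - i)\<close> is taken out. For nonconstant \<open>f\<close> its degree rises by at
  most \<open>degree f - 1\<close> per derivative, which keeps the number of vanishing conditions
  small.\<close>

primrec power_cofactor :: "int poly \<Rightarrow> nat \<Rightarrow> nat \<Rightarrow> int poly \<Rightarrow> int poly" where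
  "power_cofactor f n 0 k = k"
| "power_cofactor f n (Suc i) k =
     smult (int n - int i) (pderiv f * power_cofactor f n i k) + f * pderiv (power_cofactor f n i k)"

lemma higher_pderiv_power_mult:
  "i \<le> n \<Longrightarrow> (pderiv ^^ i) (f ^ n * k) = f ^ (n - i) * power_cofactor f n i k"
proof (induction i)
  case (Suc i)
  then obtain d where d: "n = Suc (i + d)"
    by (metis Suc_le_D add_Suc le_Suc_ex)
  have "(pderiv ^^ Suc i) (f ^ n * k) = pderiv (f ^ Suc d * power_cofactor f n i k)"
    using Suc d by simp
  also have "\<dots> = f ^ d * power_cofactor f n (Suc i) k"
    unfolding pderiv_mult pderiv_power_Suc using d by (simp add: algebra_simps)
  finally show ?case using d by simp
qed simp

lemma power_cofactor_diff:
  "power_cofactor f n i (k - l) = power_cofactor f n i k - power_cofactor f n i l"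
proof (induction i)
  case (Suc i)
  then show ?case
    by (simp only: power_cofactor.simps pderiv_diff right_diff_distrib smult_diff_right
        diff_add_eq diff_diff_add add_diff_eq ac_simps)
qed simp

lemma degree_power_cofactor:
  assumes "degree f > 0"
  shows "degree (power_cofactor f n i k) \<le> degree k + i * (degree f - 1)"
proof (induction i)
  case (Suc i)
  let ?t = "power_cofactor f n i k"
  have "degree (smult (int n - int i) (pderiv f * ?t)) \<le> (degree f - 1) + degree ?t"
    by (metis degree_mult_le degree_pderiv degree_smult_le le_trans)
  moreover have "degree (f * pderiv ?t) \<le> (degree f - 1) + degree ?t"
  proof (cases "degree ?t = 0")
    case True
    then have "pderiv ?t = 0" by (simp add: pderiv_eq_0_iff)
    then show ?thesis by simp
  next
    case False
    have "degree (f * pderiv ?t) \<le> degree f + (degree ?t - 1)"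
      by (metis degree_mult_le degree_pderiv)
    then show ?thesis using False assms by simp
  qed
  ultimately have "degree (power_cofactor f n (Suc i) k) \<le> (degree f - 1) + degree ?t"
    by (auto intro: degree_add_le)
  then show ?case using Suc by simp
qed simp

section \<open>Fermat and Frobenius modulo \<open>p\<close>\<close>

lemma fermat_int: "prime p \<Longrightarrow> [x ^ p = x] (mod int p)" for x :: int
proof -
  assume p: "prime p"
  define y where "y = nat (x mod int p)"
  have p0: "int p > 0" using p prime_gt_0_nat by auto
  have y: "[x = int y] (mod int p)" using p0 by (simp add: y_def cong_def)
  have "[y ^ p = y] (mod p)"
  proof (cases "p dvd y")
    case True
    then have "p dvd y ^ p" using p prime_gt_0_nat by (simp add: dvd_power_iff_le dvd_trans[OF _ dvd_power])
    then show ?thesis using True by (metis cong_0_iff cong_sym cong_trans)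
  next
    case False
    then have "[y ^ (p - 1) * y = 1 * y] (mod p)"
      using fermat_theorem[OF p] by (intro cong_mult) auto
    moreover have "y ^ (p - 1) * y = y ^ p" by (intro power_minus_mult prime_gt_0_nat p)
    ultimately show ?thesis by simp
  qed
  then have "[int y ^ p = int y] (mod int p)"
    by (metis cong_int_iff of_nat_power)
  then show ?thesis using y by (meson cong_pow cong_sym cong_trans)
qed

lemma const_dvd_add_power_prime:
  fixes a b :: "int poly"
  assumes "prime p"
  shows "[:int p:] dvd (a + b) ^ p - (a ^ p + b ^ p)"
proof -
  have p: "p > 0" using assms prime_gt_0_nat by auto
  have "(a + b) ^ p = (\<Sum>k\<le>p. of_nat (p choose k) * a ^ k * b ^ (p - k))"
    by (rule binomial_ring)
  also have "{..p} = insert 0 (insert p {1..<p})" using p by auto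
  also have "(\<Sum>k\<in>\<dots>. of_nat (p choose k) * a ^ k * b ^ (p - k)) =
      b ^ p + (a ^ p + (\<Sum>k\<in>{1..<p}. of_nat (p choose k) * a ^ k * b ^ (p - k)))"
    using p by (subst sum.insert, simp, simp, subst sum.insert) auto
  finally have "(a + b) ^ p - (a ^ p + b ^ p) =
      (\<Sum>k\<in>{1..<p}. of_nat (p choose k) * a ^ k * b ^ (p - k))" by simp
  moreover have "[:int p:] dvd of_nat (p choose k) * a ^ k * b ^ (p - k)" if "k \<in> {1..<p}" for k
  proof -
    have "p dvd (p choose k)" using that assms by (intro dvd_choose_prime) auto
    then have "[:int p:] dvd of_nat (p choose k)"
      by (simp add: of_nat_poly)
    then show ?thesis by (simp add: mult.assoc dvd_mult2)
  qed
  ultimately show ?thesis by (metis (no_types, lifting) dvd_sum)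
qed

text \<open>Frobenius applied to \<open>f = f(0) + X g\<close>. Modulo \<open>p\<close> and
  \<open>X ^ p\<close>, the power \<open>f ^ p\<close> is thus a constant, which removes the high
  power of \<open>f\<close> in the non-vanishing argument.\<close>

lemma power_prime_mod_monom:
  fixes f :: "int poly"
  assumes "prime p"
  obtains w where "[:int p:] dvd f ^ p - ([:poly f 0 ^ p:] + monom 1 p * w)"
proof -
  obtain c g where f: "f = pCons c g" by (cases f)
  have "f = [:c:] + [:0, 1:] * g" by (simp add: f)
  then have "[:int p:] dvd f ^ p - ([:c:] ^ p + ([:0, 1:] * g) ^ p)"
    using const_dvd_add_power_prime[OF assms] by metis
  moreover have "[:c:] ^ p = [:poly f 0 ^ p:]"
    by (simp add: f poly_const_pow)
  moreover have "([:0, 1:] * g) ^ p = monom 1 p * g ^ p"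
    by (simp only: power_mult_distrib monom_altdef smult_1_left)
  ultimately show ?thesis using that by metis
qed

text \<open>Multiples of \<open>X ^ n\<close> leave the coefficients below \<open>n\<close>
  alone.\<close>

lemma const_dvd_of_low_degree:
  fixes a :: "int poly"
  assumes "[:q:] dvd a + monom 1 n * r" "degree a < n"
  shows "[:q:] dvd a"
  unfolding const_poly_dvd_iff
proof
  fix k
  show "q dvd coeff a k"
  proof (cases "k < n")
    case True
    then have "coeff (a + monom 1 n * r) k = coeff a k" by (simp add: coeff_monom_mult)
    then show ?thesis using assms(1) unfolding const_poly_dvd_iff by metis
  next
    case False
    then show ?thesis using assms(2) by (simp add: coeff_eq_0)
  qed
qed

text \<open>The order of vanishing at \<open>b\<close> is odd for
  \<open>k0\<^sup>2 (X - b) f1\<close> and even for \<open>c k1\<^sup>2\<close>. The first vanishes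
  at \<open>b\<close>, hence so does \<open>k1\<close>; cancelling one \<open>X - b\<close> shows
  the same for \<open>k0\<close>, because \<open>f1\<close> does not vanish there. Dividing both by
  \<open>X - b\<close> reproduces the congruence. The last conclusion serves constants, whose
  truncated degree cannot drop.\<close>

lemma nonsquare_descent_step:
  fixes k0 k1 f1 :: "int poly"
  assumes p: "prime p" and f1: "\<not> int p dvd poly f1 b" and c: "\<not> int p dvd c"
    and dvd: "[:int p:] dvd k0\<^sup>2 * ([:- b, 1:] * f1) - [:c:] * k1\<^sup>2"
  obtains l0 l1 where "[:int p:] dvd l0\<^sup>2 * ([:- b, 1:] * f1) - [:c:] * l1\<^sup>2"
    "degree l0 = degree k0 - 1" "degree l1 = degree k1 - 1"
    "[:int p:] dvd k0 - [:- b, 1:] * l0" "[:int p:] dvd k1 - [:- b, 1:] * l1"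
    "degree k0 = 0 \<longrightarrow> l0 = 0" "degree k1 = 0 \<longrightarrow> l1 = 0"
proof -
  define X where "X = [:- b, 1:]"
  define P where "P = [:int p:]"
  define C where "C = [:c:]"
  define l0 where "l0 = synthetic_div k0 b"
  define l1 where "l1 = synthetic_div k1 b"
  have X: "poly X b = 0" by (simp add: X_def)
  have pr: "prime (int p)" using p by simp
  have prP: "prime_elem P" unfolding P_def using p by (rule prime_elem_const_int_poly)
  have nX: "\<not> P dvd X"
    using p by (auto simp: P_def X_def const_poly_dvd_iff intro!: exI[of _ 1])
  have dvd': "P dvd k0\<^sup>2 * (X * f1) - C * k1\<^sup>2" using dvd by (simp only: P_def X_def C_def)
  have syn: "k - X * synthetic_div k b = [:poly k b:]" for k
    using synthetic_div_correct'[of b k] by (simp add: X_def algebra_simps)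
  have "int p dvd poly (k0\<^sup>2 * (X * f1) - C * k1\<^sup>2) b"
    using dvd' unfolding P_def by (rule const_dvd_imp_dvd_poly)
  then have "int p dvd c * (poly k1 b)\<^sup>2" by (simp add: X C_def)
  then have "int p dvd poly k1 b" using c pr by (metis prime_dvd_multD prime_dvd_power)
  then have d1: "P dvd k1 - X * l1" by (simp add: syn l1_def P_def)
  have "P dvd (k0\<^sup>2 * (X * f1) - C * k1\<^sup>2) + (k1 - X * l1) * (C * (k1 + X * l1))"
    using dvd' d1 by (intro dvd_add dvd_mult2)
  also have "\<dots> = X * (k0\<^sup>2 * f1 - C * X * l1\<^sup>2)" by (simp add: algebra_simps power2_eq_square)
  finally have e1: "P dvd k0\<^sup>2 * f1 - C * X * l1\<^sup>2"
    using prP nX prime_elem_dvd_multD by blast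
  then have "int p dvd poly (k0\<^sup>2 * f1 - C * X * l1\<^sup>2) b"
    unfolding P_def by (rule const_dvd_imp_dvd_poly)
  then have "int p dvd (poly k0 b)\<^sup>2 * poly f1 b" by (simp add: X)
  then have "int p dvd poly k0 b" using f1 pr by (metis prime_dvd_multD prime_dvd_power)
  then have d0: "P dvd k0 - X * l0" by (simp add: syn l0_def P_def)
  have "P dvd (k0\<^sup>2 * f1 - C * X * l1\<^sup>2) - (k0 - X * l0) * (f1 * (k0 + X * l0))"
    by (rule dvd_diff[OF e1 dvd_mult2[OF d0]])
  also have "\<dots> = X * (l0\<^sup>2 * (X * f1) - C * l1\<^sup>2)" by (simp add: algebra_simps power2_eq_square)
  finally have "P dvd l0\<^sup>2 * (X * f1) - C * l1\<^sup>2"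
    using prP nX prime_elem_dvd_multD by blast
  then show ?thesis
    using that[of l0 l1] d0 d1
    by (simp add: P_def X_def C_def l0_def l1_def degree_synthetic_div synthetic_div_eq_0_iff del: mult_pCons_left)
qed

text \<open>Infinite descent on the degree: modulo \<open>p\<close>, a polynomial with a simple root
  is not a constant times the square of a rational function.\<close>

lemma nonsquare_descent:
  fixes k0 k1 f1 :: "int poly"
  assumes p: "prime p" and f1: "\<not> int p dvd poly f1 b" and c: "\<not> int p dvd c"
    and "[:int p:] dvd k0\<^sup>2 * ([:- b, 1:] * f1) - [:c:] * k1\<^sup>2" "degree k0 \<le> n" "degree k1 \<le> n"
  shows "[:int p:] dvd k0 \<and> [:int p:] dvd k1"
  using assms(4-)
proof (induction n arbitrary: k0 k1)
  case 0
  then show ?case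
    using nonsquare_descent_step[OF p f1 c, of k0 k1] by fastforce
next
  case (Suc n)
  obtain l0 l1 where l: "[:int p:] dvd l0\<^sup>2 * ([:- b, 1:] * f1) - [:c:] * l1\<^sup>2"
    "degree l0 = degree k0 - 1" "degree l1 = degree k1 - 1"
    "[:int p:] dvd k0 - [:- b, 1:] * l0" "[:int p:] dvd k1 - [:- b, 1:] * l1"
    using nonsquare_descent_step[OF p f1 c Suc.prems(1)] by blast
  have "[:int p:] dvd l0 \<and> [:int p:] dvd l1"
    using Suc.prems l by (intro Suc.IH) auto
  then have "[:int p:] dvd (k0 - [:- b, 1:] * l0) + [:- b, 1:] * l0 \<and>
      [:int p:] dvd (k1 - [:- b, 1:] * l1) + [:- b, 1:] * l1"
    using l(4,5) by (meson dvd_add dvd_mult)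
  then show ?case by simp
qed

text \<open>Strong induction on \<open>j\<close>: the earlier terms vanish modulo \<open>p\<close>,
  and cancelling \<open>X ^ (j * p)\<close> leaves \<open>k0 j + k1 j * f ^ c\<close> congruent to 0
  modulo \<open>X ^ p\<close>. Multiplying by \<open>f * (k0 j - k1 j * f ^ c)\<close> yields
  \<open>(k0 j)\<^sup>2 * f - (k1 j)\<^sup>2 * f ^ p\<close>, where Frobenius replaces
  \<open>f ^ p\<close> by a constant. The degree is then below \<open>p\<close>, so the expression
  is 0 modulo \<open>p\<close> outright, and the descent applies.\<close>

lemma stepanov_nonvanishing:
  fixes f f1 :: "int poly" and k0 k1 :: "nat \<Rightarrow> int poly"
  assumes p: "prime p" "p = 2 * c + 1" and f: "f = [:- b, 1:] * f1" "\<not> int p dvd poly f1 b"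
    and f0: "\<not> int p dvd poly f 0"
    and deg: "\<And>j. j < J \<Longrightarrow> 2 * degree (k0 j) + degree f < p"
      "\<And>j. j < J \<Longrightarrow> 2 * degree (k1 j) < p"
    and dvd: "[:int p:] dvd (\<Sum>j<J. (k0 j + k1 j * f ^ c) * monom 1 (j * p))"
    and "j < J"
  shows "[:int p:] dvd k0 j \<and> [:int p:] dvd k1 j"
  using \<open>j < J\<close>
proof (induction j rule: less_induct)
  case (less j)
  define P where "P = [:int p:]"
  define u where "u = (\<lambda>j. k0 j + k1 j * f ^ c)"
  define Y :: "int poly" where "Y = monom 1 p"
  have pr: "prime_elem P" unfolding P_def using p(1) by (rule prime_elem_const_int_poly)
  define R where "R = (\<Sum>i\<in>{j<..<J}. u i * monom 1 ((i - Suc j) * p))"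
  have "(\<Sum>i<J. u i * monom 1 (i * p)) =
      (\<Sum>i<j. u i * monom 1 (i * p)) + (\<Sum>i\<in>{j..<J}. u i * monom 1 (i * p))"
    using less.prems sum.atLeastLessThan_concat[of 0 j J "\<lambda>i. u i * monom 1 (i * p)"]
    by (simp add: lessThan_atLeast0)
  also have "(\<Sum>i\<in>{j..<J}. u i * monom 1 (i * p)) =
      u j * monom 1 (j * p) + (\<Sum>i\<in>{j<..<J}. u i * monom 1 (i * p))"
    using less.prems by (subst sum.atLeast_Suc_lessThan) (auto simp: atLeastSucLessThan_greaterThanLessThan)
  also have "(\<Sum>i\<in>{j<..<J}. u i * monom 1 (i * p)) = monom 1 (j * p) * (Y * R)"
  proof -
    have "monom 1 (i * p) = monom 1 (j * p) * (Y * monom 1 ((i - Suc j) * p))"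
      if i: "i \<in> {j<..<J}" for i
    proof -
      obtain d where "i = Suc j + d" using i less_iff_Suc_add[of j i] by auto
      then show ?thesis by (simp add: Y_def mult_monom algebra_simps)
    qed
    then show ?thesis unfolding R_def sum_distrib_left
      by (intro sum.cong) (simp_all add: algebra_simps)
  qed
  finally have eq: "(\<Sum>i<J. u i * monom 1 (i * p)) =
      (\<Sum>i<j. u i * monom 1 (i * p)) + monom 1 (j * p) * (u j + Y * R)"
    by (simp add: algebra_simps)
  have "P dvd (\<Sum>i<j. u i * monom 1 (i * p))"
    using less by (intro dvd_sum) (auto simp: u_def P_def intro!: dvd_mult2 dvd_add)
  moreover have "P dvd (\<Sum>i<j. u i * monom 1 (i * p)) + monom 1 (j * p) * (u j + Y * R)"
    unfolding eq[symmetric] using dvd unfolding P_def u_def .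
  ultimately have "P dvd monom 1 (j * p) * (u j + Y * R)"
    by (simp only: dvd_add_right_iff)
  moreover have "\<not> P dvd monom 1 (j * p)"
    unfolding P_def const_poly_dvd_iff using p(1) by (auto intro!: exI[of _ "j * p"])
  ultimately have main: "P dvd u j + Y * R"
    using pr prime_elem_dvd_multD by blast
  obtain w where w: "P dvd f ^ p - ([:poly f 0 ^ p:] + Y * w)"
    using power_prime_mod_monom[OF p(1), of f] unfolding P_def Y_def by blast
  define C where "C = [:poly f 0 ^ p:]"
  define g where "g = f ^ c"
  have fp: "f ^ p = f * g * g" by (simp add: g_def p(2) power_add mult_2)
  have "P dvd (u j + Y * R) * (f * (k0 j - k1 j * g)) + (k1 j)\<^sup>2 * (f ^ p - (C + Y * w))"
    using dvd_add[OF dvd_mult2[OF main] dvd_mult[OF w]] unfolding C_def .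
  also have "(u j + Y * R) * (f * (k0 j - k1 j * g)) + (k1 j)\<^sup>2 * (f ^ p - (C + Y * w)) =
     ((k0 j)\<^sup>2 * f - C * (k1 j)\<^sup>2) + Y * (R * (f * (k0 j - k1 j * g)) - (k1 j)\<^sup>2 * w)"
    unfolding fp u_def g_def[symmetric] by (simp add: algebra_simps power2_eq_square)
  finally have "P dvd ((k0 j)\<^sup>2 * f - C * (k1 j)\<^sup>2) + Y * (R * (f * (k0 j - k1 j * g)) - (k1 j)\<^sup>2 * w)" .
  moreover have "degree ((k0 j)\<^sup>2 * f - C * (k1 j)\<^sup>2) < p"
  proof -
    have "degree ((k0 j)\<^sup>2 * f) \<le> degree (k0 j) * 2 + degree f"
      by (rule order_trans[OF degree_mult_le]) (simp add: degree_power_le)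
    moreover have "degree (C * (k1 j)\<^sup>2) \<le> degree (k1 j) * 2"
      unfolding C_def by (simp add: degree_power_le order_trans[OF degree_smult_le])
    ultimately show ?thesis using deg[of j] less.prems by (intro degree_diff_less) auto
  qed
  ultimately have "P dvd (k0 j)\<^sup>2 * f - C * (k1 j)\<^sup>2"
    unfolding P_def Y_def by (rule const_dvd_of_low_degree)
  moreover have "\<not> int p dvd poly f 0 ^ p"
    using f0 p(1) by (meson prime_dvd_power prime_nat_int_transfer)
  ultimately show ?case
    using nonsquare_descent[OF p(1) f(2), of "poly f 0 ^ p" "k0 j" "k1 j" "max (degree (k0 j)) (degree (k1 j))"]
    unfolding f(1)[symmetric] P_def C_def by simp
qed

text \<open>Pigeonhole in place of linear algebra: there are more vectors with entries in
  \<open>{0..<q}\<close> than tuples of residues, and the difference of two colliding vectors is the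
  solution. This is why linearity is asked for as compatibility with differences.\<close>

lemma exists_nontrivial_zero_mod:
  fixes \<Phi> :: "('i \<Rightarrow> int) \<Rightarrow> 'e \<Rightarrow> int"
  assumes fin: "finite I" "finite E" and card: "card E < card I" and q: "q > 1"
    and diff: "\<And>v w e. \<Phi> (\<lambda>i. v i - w i) e = \<Phi> v e - \<Phi> w e"
  obtains v i where "i \<in> I" "\<not> int q dvd v i" "\<And>e. e \<in> E \<Longrightarrow> int q dvd \<Phi> v e"
proof -
  define D where "D = I \<rightarrow>\<^sub>E {0..<int q}"
  define G where "G = (\<lambda>v. restrict (\<lambda>e. \<Phi> v e mod int q) E)"
  have finD: "finite D" using fin by (simp add: D_def finite_PiE)
  have "G ` D \<subseteq> E \<rightarrow>\<^sub>E {0..<int q}"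
    using q by (auto simp: G_def)
  then have "card (G ` D) \<le> card (E \<rightarrow>\<^sub>E {0..<int q})"
    using fin by (intro card_mono finite_PiE) auto
  also have "\<dots> = q ^ card E" using fin by (simp add: card_PiE)
  also have "\<dots> < q ^ card I" using q card by simp
  also have "\<dots> = card D" using fin by (simp add: D_def card_PiE)
  finally have "\<not> inj_on G D" using card_image by fastforce
  then obtain v w where vw: "v \<in> D" "w \<in> D" "v \<noteq> w" "G v = G w"
    by (auto simp: inj_on_def)
  obtain i where i: "i \<in> I" "v i \<noteq> w i"
    using vw(1-3) unfolding D_def by (metis PiE_ext)
  have "v i \<in> {0..<int q}" "w i \<in> {0..<int q}"
    using vw(1,2) i(1) unfolding D_def by (auto dest!: PiE_mem)
  then have "\<bar>v i - w i\<bar> < int q" by auto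
  then have nd: "\<not> int q dvd v i - w i"
    using i(2) dvd_imp_le_int[of "v i - w i" "int q"] by auto
  have "int q dvd \<Phi> (\<lambda>i. v i - w i) e" if "e \<in> E" for e
  proof -
    have "G v e = G w e" using vw by simp
    then have "\<Phi> v e mod int q = \<Phi> w e mod int q" using that by (simp add: G_def)
    then show ?thesis unfolding diff by (simp add: mod_eq_dvd_iff)
  qed
  with i(1) nd show ?thesis by (rule that)
qed

text \<open>\<open>X ^ (j * p)\<close> has derivative 0 modulo \<open>p\<close>, so it behaves like
  a constant under differentiation.\<close>

lemma higher_pderiv_mult_monom_prime:
  fixes u :: "int poly"
  shows "[:int p:] dvd (pderiv ^^ i) (u * monom 1 (j * p)) - (pderiv ^^ i) u * monom 1 (j * p)"
proof (induction i)
  case (Suc i)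
  let ?m = "monom 1 (j * p) :: int poly"
  have "(pderiv ^^ Suc i) (u * ?m) - (pderiv ^^ Suc i) u * ?m =
      pderiv ((pderiv ^^ i) (u * ?m) - (pderiv ^^ i) u * ?m) + (pderiv ^^ i) u * pderiv ?m"
    by (simp add: pderiv_diff pderiv_mult algebra_simps)
  moreover have "[:int p:] dvd pderiv ((pderiv ^^ i) (u * ?m) - (pderiv ^^ i) u * ?m)"
    using const_dvd_pderiv[OF Suc, of 1] by simp
  moreover have "[:int p:] dvd pderiv ?m"
    by (auto simp: pderiv_monom const_poly_dvd_iff)
  ultimately show ?case by (metis dvd_add dvd_mult)
qed simp

text \<open>
  The pigeonhole principle provides polynomials \<open>k\<^sub>0\<^sub>j\<close>, \<open>k\<^sub>1\<^sub>j\<close> for which the auxiliary polynomial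
  \<open>h = \<Sum>\<^sub>j (f\<^sup>l k\<^sub>0\<^sub>j + f\<^sup>l\<^sup>+\<^sup>c k\<^sub>1\<^sub>j) x\<^sup>j\<^sup>p\<close> is nonzero modulo \<open>p\<close> and vanishes to order \<open>l\<close>
  at every point where \<open>f\<^sup>c \<equiv> e\<close>.
\<close>

lemma stepanov_bound:
  fixes f f1 :: "int poly" and S :: "int set"
  assumes p: "prime p" "p = 2 * c + 1" and f: "f = [:- b, 1:] * f1" "\<not> int p dvd poly f1 b"
    and lead: "lead_coeff f = 1"
    and f0: "\<not> int p dvd poly f 0"
    and S: "S \<subseteq> {0..<int p}" "\<And>x. x \<in> S \<Longrightarrow> [poly f x ^ c = e] (mod int p)"
    and K: "K > 0" "2 * (K - 1) + degree f < p" and l: "l \<le> p" and J: "J > 0"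
    and count: "(\<Sum>i<l. K + i * (degree f - 1) + J) < 2 * J * K"
  shows "card S * l \<le> (l + c) * degree f + (K - 1) + (J - 1) * p"
proof -
  define m where "m = degree f"
  have m: "m > 0"
  proof -
    have "f1 \<noteq> 0" using f(2) by auto
    then show ?thesis unfolding m_def f(1) by (simp add: degree_mult_eq del: mult_pCons_left)
  qed
  \<comment> \<open>Unknowns: a coefficient for each choice between \<open>k0\<close> and
    \<open>k1\<close>, each \<open>j\<close> and each degree below \<open>K\<close>. Conditions, in
    \<open>E\<close>: for each order \<open>i < l\<close>, all coefficients of \<open>G v i\<close>,
    whose degree is below \<open>K + i * (m - 1) + J\<close>. Thus \<open>count\<close> says that
    the unknowns outnumber the conditions.\<close>
  define I :: "(bool \<times> nat \<times> nat) set" where "I = UNIV \<times> {..<J} \<times> {..<K}"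
  define E :: "(nat \<times> nat) set" where "E = (SIGMA i:{..<l}. {..<K + i * (m - 1) + J})"
  define k :: "(bool \<times> nat \<times> nat \<Rightarrow> int) \<Rightarrow> bool \<Rightarrow> nat \<Rightarrow> int poly" where
    "k = (\<lambda>v s j. \<Sum>n<K. monom (v (s, j, n)) n)"
  \<comment> \<open>On \<open>S\<close>, the \<open>i\<close>-th derivative of the auxiliary
    polynomial is congruent to \<open>f ^ (l - i)\<close> times \<open>G v i\<close>: there
    \<open>f ^ c\<close> may be replaced by \<open>e\<close> and \<open>x ^ p\<close> by
    \<open>x\<close>, so that \<open>x ^ (j * p)\<close> collapses to \<open>x ^ j\<close> and the
    degree stays small.\<close>
  define G :: "(bool \<times> nat \<times> nat \<Rightarrow> int) \<Rightarrow> nat \<Rightarrow> int poly" where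
    "G = (\<lambda>v i. \<Sum>j<J. (power_cofactor f l i (k v False j) +
                      smult e (power_cofactor f (l + c) i (k v True j))) * monom 1 j)"
  have k_diff: "k (\<lambda>i. v i - w i) s j = k v s j - k w s j" for v w s j
    by (simp add: k_def diff_monom[symmetric] sum_subtractf)
  have coeff_k: "coeff (k v s j) n = (if n < K then v (s, j, n) else 0)" for v s j n
    by (auto simp: k_def coeff_sum)
  have deg_k: "degree (k v s j) \<le> K - 1" for v s j
    using K(1) by (intro degree_le) (auto simp: coeff_k)
  have "card I = 2 * J * K" by (simp add: I_def card_cartesian_product UNIV_bool)
  moreover have "card E = (\<Sum>i<l. K + i * (m - 1) + J)" by (simp add: E_def)
  ultimately have "card E < card I" using count by (simp add: m_def)
  moreover have "finite I" "finite E" by (auto simp: I_def E_def)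
  moreover have "coeff (G (\<lambda>i. v i - w i) (fst e)) (snd e) = coeff (G v (fst e)) (snd e) - coeff (G w (fst e)) (snd e)"
    for v w e
    unfolding G_def k_diff power_cofactor_diff smult_diff_right coeff_diff[symmetric] sum_subtractf[symmetric]
    by (intro arg_cong[of _ _ "\<lambda>q. coeff q _"] sum.cong) (simp_all add: algebra_simps)
  ultimately obtain v i0 where v: "i0 \<in> I" "\<not> int p dvd v i0"
      "\<And>e. e \<in> E \<Longrightarrow> int p dvd coeff (G v (fst e)) (snd e)"
    using exists_nontrivial_zero_mod[of I E p "\<lambda>v e. coeff (G v (fst e)) (snd e)"] prime_gt_1_nat[OF p(1)]
    by metis
  define k0 where "k0 = k v False"
  define k1 where "k1 = k v True"
  have G0: "[:int p:] dvd G v i" if "i < l" for i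
    unfolding const_poly_dvd_iff
  proof
    fix n
    show "int p dvd coeff (G v i) n"
    proof (cases "n < K + i * (m - 1) + J")
      case True
      then show ?thesis using v(3)[of "(i, n)"] that by (simp add: E_def)
    next
      case False
      have "degree (G v i) \<le> (K - 1 + i * (m - 1)) + (J - 1)"
        unfolding G_def
      proof (intro degree_sum_le order_trans[OF degree_mult_le] add_mono degree_add_le
            order_trans[OF degree_smult_le])
        fix j assume "j \<in> {..<J}"
        then show "degree (monom 1 j :: int poly) \<le> J - 1"
          by (simp add: degree_monom_eq)
        show "degree (power_cofactor f l i (k v False j)) \<le> K - 1 + i * (m - 1)"
          using degree_power_cofactor[of f l i "k v False j"] deg_k[of v False j] m
          unfolding m_def by linarith
        show "degree (power_cofactor f (l + c) i (k v True j)) \<le> K - 1 + i * (m - 1)"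
          using degree_power_cofactor[of f "l + c" i "k v True j"] deg_k[of v True j] m
          unfolding m_def by linarith
      qed simp
      then have "coeff (G v i) n = 0" using False K(1) J by (intro coeff_eq_0) linarith
      then show ?thesis by simp
    qed
  qed
  define u where "u = (\<lambda>j. f ^ l * k0 j + f ^ (l + c) * k1 j)"
  define h where "h = (\<Sum>j<J. u j * monom 1 (j * p))"
  have vanish: "int p dvd poly ((pderiv ^^ i) h) x" if x: "x \<in> S" and i: "i < l" for x i
  proof -
    have "[:int p:] dvd (\<Sum>j<J. (pderiv ^^ i) (u j * monom 1 (j * p)) - (pderiv ^^ i) (u j) * monom 1 (j * p))"
      by (intro dvd_sum higher_pderiv_mult_monom_prime)
    then have "[:int p:] dvd (pderiv ^^ i) h - (\<Sum>j<J. (pderiv ^^ i) (u j) * monom 1 (j * p))"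
      by (simp add: h_def higher_pderiv_sum sum_subtractf)
    then have "int p dvd poly ((pderiv ^^ i) h - (\<Sum>j<J. (pderiv ^^ i) (u j) * monom 1 (j * p))) x"
      by (rule const_dvd_imp_dvd_poly)
    then have c1: "[poly ((pderiv ^^ i) h) x = (\<Sum>j<J. poly ((pderiv ^^ i) (u j)) x * x ^ (j * p))] (mod int p)"
      by (simp add: cong_iff_dvd_diff poly_sum poly_monom)
    define A where "A = (\<lambda>j. poly (power_cofactor f l i (k0 j)) x)"
    define B where "B = (\<lambda>j. poly (power_cofactor f (l + c) i (k1 j)) x)"
    have "poly ((pderiv ^^ i) (u j)) x = poly f x ^ (l - i) * (A j + poly f x ^ c * B j)" for j
    proof -
      have "l + c - i = (l - i) + c" using i by simp
      moreover have "(pderiv ^^ i) (u j) = f ^ (l - i) * power_cofactor f l i (k0 j) +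
          f ^ (l + c - i) * power_cofactor f (l + c) i (k1 j)"
        using i by (simp add: u_def higher_pderiv_add higher_pderiv_power_mult)
      ultimately show ?thesis by (simp add: A_def B_def power_add algebra_simps)
    qed
    moreover have "[poly f x ^ (l - i) * (A j + poly f x ^ c * B j) * (x ^ p) ^ j =
        poly f x ^ (l - i) * (A j + e * B j) * x ^ j] (mod int p)" for j
    proof -
      have "[poly f x ^ c * B j = e * B j] (mod int p)"
        by (rule cong_mult[OF S(2)[OF x] cong_refl])
      moreover have "[(x ^ p) ^ j = x ^ j] (mod int p)"
        by (rule cong_pow[OF fermat_int[OF p(1)]])
      ultimately show ?thesis by (meson cong_add cong_mult cong_refl)
    qed
    ultimately have "[(\<Sum>j<J. poly ((pderiv ^^ i) (u j)) x * x ^ (j * p)) =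
        (\<Sum>j<J. poly f x ^ (l - i) * (A j + e * B j) * x ^ j)] (mod int p)"
      by (intro cong_sum) (simp only: power_mult[symmetric] mult.commute[of _ p])
    also have "(\<Sum>j<J. poly f x ^ (l - i) * (A j + e * B j) * x ^ j) = poly f x ^ (l - i) * poly (G v i) x"
      by (simp add: G_def A_def B_def k0_def k1_def poly_sum poly_monom sum_distrib_left mult.assoc)
    finally have "[poly ((pderiv ^^ i) h) x = poly f x ^ (l - i) * poly (G v i) x] (mod int p)"
      using c1 cong_trans by blast
    moreover have "int p dvd poly f x ^ (l - i) * poly (G v i) x"
      using const_dvd_imp_dvd_poly[OF G0[OF i]] by simp
    ultimately show ?thesis using cong_dvd_iff by blast
  qed
  \<comment> \<open>As \<open>f\<close> is monic, it is not 0 modulo \<open>p\<close> and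
    \<open>f ^ l\<close> can be cancelled. Then \<open>stepanov_nonvanishing\<close> would make the
    coefficient \<open>v i0\<close> divisible by \<open>p\<close>.\<close>
  have "\<not> [:int p:] dvd h"
  proof
    assume *: "[:int p:] dvd h"
    have "h = f ^ l * (\<Sum>j<J. (k0 j + k1 j * f ^ c) * monom 1 (j * p))"
      by (simp add: h_def u_def sum_distrib_left power_add algebra_simps)
    then have "[:int p:] dvd f ^ l * (\<Sum>j<J. (k0 j + k1 j * f ^ c) * monom 1 (j * p))"
      using * by (simp only:)
    then have "[:int p:] dvd f ^ l \<or>
        [:int p:] dvd (\<Sum>j<J. (k0 j + k1 j * f ^ c) * monom 1 (j * p))"
      by (rule prime_elem_dvd_multD[OF prime_elem_const_int_poly[OF p(1)]])
    moreover have "\<not> [:int p:] dvd f"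
    proof
      assume "[:int p:] dvd f"
      then have "int p dvd lead_coeff f" unfolding const_poly_dvd_iff by blast
      then show False using lead p(1) by auto
    qed
    then have "\<not> [:int p:] dvd f ^ l"
      using prime_elem_dvd_power[OF prime_elem_const_int_poly[OF p(1)]] by blast
    ultimately have "[:int p:] dvd (\<Sum>j<J. (k0 j + k1 j * f ^ c) * monom 1 (j * p))"
      by blast
    note sum_dvd = this
    have dv: "[:int p:] dvd k0 j \<and> [:int p:] dvd k1 j" if "j < J" for j
    proof (rule stepanov_nonvanishing[OF p f f0 _ _ sum_dvd that])
      show "2 * degree (k0 j) + degree f < p" for j
        using deg_k[of v False j] K(2) unfolding k0_def by linarith
      show "2 * degree (k1 j) < p" for j
        using deg_k[of v True j] K(2) unfolding k1_def by linarith
    qed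
    obtain s j n where i0: "i0 = (s, j, n)" "j < J" "n < K" using v(1) by (auto simp: I_def)
    have "[:int p:] dvd k v s j" using dv[OF i0(2)] by (cases s) (simp_all add: k0_def k1_def)
    then have "int p dvd coeff (k v s j) n" unfolding const_poly_dvd_iff by blast
    then show False using v(2) i0 by (simp add: coeff_k)
  qed
  moreover have "finite S" using S(1) by (rule finite_subset) simp
  ultimately have "(\<Sum>_\<in>S. l) \<le> degree h"
    using sum_multiplicities_le_degree[of p S h "\<lambda>_. l"] p(1) S(1) l vanish by blast
  also have "degree h \<le> (l + c) * m + (K - 1) + (J - 1) * p"
    unfolding h_def
  proof (intro degree_sum_le order_trans[OF degree_mult_le] add_mono)
    fix j assume "j \<in> {..<J}"
    then have "j \<le> J - 1" by simp
    then show "degree (monom 1 (j * p) :: int poly) \<le> (J - 1) * p"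
      by (simp add: degree_monom_eq)
    show "degree (u j) \<le> (l + c) * m + (K - 1)"
      unfolding u_def
    proof (intro degree_add_le order_trans[OF degree_mult_le] add_mono)
      show "degree (f ^ l) \<le> (l + c) * m"
        by (rule order_trans[OF degree_power_le]) (simp add: m_def algebra_simps)
      show "degree (f ^ (l + c)) \<le> (l + c) * m"
        by (rule order_trans[OF degree_power_le]) (simp add: m_def algebra_simps)
      show "degree (k0 j) \<le> K - 1" unfolding k0_def by (rule deg_k)
      show "degree (k1 j) \<le> K - 1" unfolding k1_def by (rule deg_k)
    qed
  qed simp
  finally show ?thesis by (simp add: m_def)
qed

section \<open>Legendre symbol sums and patterns\<close>

lemma Legendre_cong: "[a = b] (mod p) \<Longrightarrow> Legendre a p = Legendre b p"
  unfolding Legendre_def QuadRes_def by (simp add: Cong.cong_def)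

lemma Legendre_cases: "Legendre a p = 0 \<or> Legendre a p = 1 \<or> Legendre a p = -1"
  by (simp add: Legendre_def)

lemma Legendre_eq_0_iff: "Legendre a p = 0 \<longleftrightarrow> p dvd a"
  by (simp add: Legendre_def cong_0_iff)

lemma Legendre_eqI:
  assumes "p > 2" "[a ^ ((p - 1) div 2) = e] (mod int p)" "prime p" "e \<in> {0, 1, -1}"
  shows "Legendre a (int p) = e"
proof -
  have "[Legendre a (int p) = e] (mod int p)"
    using euler_criterion[of p a] assms by (meson cong_trans)
  then have "int p dvd Legendre a (int p) - e" by (simp add: cong_iff_dvd_diff)
  moreover have "\<bar>Legendre a (int p) - e\<bar> \<le> 2"
    using Legendre_cases[of a "int p"] assms(4) by auto
  ultimately show ?thesis
    using dvd_imp_le_int[of "Legendre a (int p) - e" "int p"] assms(1) by force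
qed

lemma Legendre_mult:
  assumes "prime p" "p > 2"
  shows "Legendre (a * b) (int p) = Legendre a (int p) * Legendre b (int p)"
proof (rule Legendre_eqI)
  have "[a ^ ((p - 1) div 2) * b ^ ((p - 1) div 2) = Legendre a (int p) * Legendre b (int p)] (mod int p)"
    by (intro cong_mult cong_sym[OF euler_criterion] assms)
  then show "[(a * b) ^ ((p - 1) div 2) = Legendre a (int p) * Legendre b (int p)] (mod int p)"
    by (simp add: power_mult_distrib)
  show "Legendre a (int p) * Legendre b (int p) \<in> {0, 1, -1}"
    using Legendre_cases[of a "int p"] Legendre_cases[of b "int p"] by auto
qed (use assms in auto)

lemma Legendre_1: "p > 1 \<Longrightarrow> Legendre 1 p = 1"
  unfolding Legendre_def QuadRes_def by (auto simp: cong_0_iff intro!: exI[of _ 1])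

lemma Legendre_prod:
  assumes "prime p" "p > 2"
  shows "Legendre (prod f I) (int p) = (\<Prod>i\<in>I. Legendre (f i) (int p))"
  by (induction I rule: infinite_finite_induct)
     (use assms in \<open>auto simp: Legendre_mult Legendre_1\<close>)

lemma card_zero_shift_le:
  assumes "finite I" "I \<subseteq> {1..<p}" "p > 0"
  shows "card {x \<in> {..<p}. \<exists>a\<in>I. int p dvd int x + int a} \<le> card I"
proof -
  have "{x \<in> {..<p}. \<exists>a\<in>I. int p dvd int x + int a} \<subseteq> (\<lambda>a. p - a) ` I"
  proof safe
    fix x a assume "x < p" "a \<in> I" "int p dvd int x + int a"
    then obtain k where k: "x + a = p * k" by (metis dvd_def int_dvd_int_iff of_nat_add)
    have "0 < x + a" "x + a < 2 * p" using \<open>x < p\<close> \<open>a \<in> I\<close> assms(2) by auto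
    then have "0 < k" "k < 2" using k assms(3) by (auto intro!: gr0I)
    then have "k = 1" by simp
    then show "x \<in> (\<lambda>a. p - a) ` I" using \<open>a \<in> I\<close> k by (intro image_eqI[of _ _ a]) auto
  qed
  then show ?thesis by (meson assms(1) card_image_le card_mono finite_imageI le_trans)
qed

text \<open>Stepanov's bound for the product \<open>f\<close> of the \<open>X + a\<close>, where
  Euler's criterion turns the level set into \<open>f ^ c \<equiv> e\<close>. Any factor gives the
  required simple root, because the shifts are incongruent, and \<open>f(0)\<close> is nonzero
  because no shift is 0 modulo \<open>p\<close>. Dividing by \<open>l = 2 * u\<close> turns
  \<open>u * p\<close> into the main term \<open>p / 2\<close>.\<close>

lemma Legendre_level_set_bound:
  assumes p: "prime p" and I: "finite I" "I \<subseteq> {1..<p}" "I \<noteq> {}" and e: "e \<in> {1, -1}"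
    and small: "11 * real (card I) < sqrt (real p)"
  shows "real (card {x \<in> {..<p}. Legendre (\<Prod>a\<in>I. int x + int a) (int p) = e})
           \<le> real p / 2 + 3 * real (card I) * sqrt (real p)"
proof -
  define m where "m = card I"
  define s where "s = sqrt (real p)"
  have m: "m \<ge> 1" using I by (simp add: m_def card_gt_0_iff Suc_leI)
  have s: "s * s = real p" "11 * real m < s" "s > 11" using small m by (simp_all add: s_def m_def)
  have ss: "s * s \<ge> 11 * s" using s(3) by (intro mult_right_mono) auto
  have ps: "real p \<ge> 11 * s" using s(1) ss by simp
  have p121: "p > 121"
  proof -
    have "11 * 11 < s * s" using s(3) by (intro mult_strict_mono) auto
    then show ?thesis using s(1) by linarith
  qed
  have odd: "odd p" using p p121 prime_odd_nat by auto
  define c where "c = (p - 1) div 2"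
  have c: "p = 2 * c + 1" using odd by (auto simp: c_def elim!: oddE)
  define f where "f = (\<Prod>a\<in>I. [:int a, 1:])"
  obtain a0 where a0: "a0 \<in> I" using I by blast
  define f1 where "f1 = (\<Prod>a\<in>I - {a0}. [:int a, 1:])"
  have f_eq: "f = [:- (- int a0), 1:] * f1"
    unfolding f_def f1_def using I(1) a0 by (simp add: prod.remove del: mult_pCons_left)
  have nd: "\<not> int p dvd prod g A" if A: "finite A" "\<And>a. a \<in> A \<Longrightarrow> g a \<noteq> 0 \<and> \<bar>g a\<bar> < int p" for g and A :: "nat set"
  proof
    assume "int p dvd prod g A"
    then obtain a where "a \<in> A" "int p dvd g a"
      using prime_dvd_prod_iff[OF A(1), of "int p" g] p by auto
    then show False using A(2)[of a] dvd_imp_le_int[of "g a" "int p"] by auto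
  qed
  have f1: "\<not> int p dvd poly f1 (- int a0)"
    unfolding f1_def poly_prod
  proof (rule nd)
    fix a assume a: "a \<in> I - {a0}"
    then have "1 \<le> a" "a < p" "1 \<le> a0" "a0 < p" "a \<noteq> a0" using I(2) a0 by auto
    then show "poly [:int a, 1:] (- int a0) \<noteq> 0 \<and> \<bar>poly [:int a, 1:] (- int a0)\<bar> < int p" by auto
  qed (use I in auto)
  have f0: "\<not> int p dvd poly f 0"
    unfolding f_def poly_prod
  proof (rule nd)
    fix a assume a: "a \<in> I"
    then have "1 \<le> a" "a < p" using I(2) by auto
    then show "poly [:int a, 1:] 0 \<noteq> 0 \<and> \<bar>poly [:int a, 1:] 0\<bar> < int p" by auto
  qed (use I in auto)
  have deg: "degree f = m"
    unfolding f_def m_def by (subst degree_prod_eq_sum_degree) auto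
  have lead: "lead_coeff f = 1"
    unfolding f_def by (simp add: lead_coeff_prod)
  define S where "S = int ` {x \<in> {..<p}. Legendre (\<Prod>a\<in>I. int x + int a) (int p) = e}"
  \<comment> \<open>The order of vanishing \<open>2 * u\<close> is about \<open>sqrt p\<close>, and
    \<open>K\<close> is essentially the largest value that the non-vanishing allows.
    \<open>J\<close> exceeds \<open>u\<close> by \<open>m + 1\<close>; this excess, worth
    \<open>2 * (m + 1) * K\<close> unknowns, pays for the remaining conditions because
    \<open>K \<ge> u * u + u\<close>.\<close>
  define u where "u = nat \<lfloor>s / 2\<rfloor>"
  have u: "real u \<le> s / 2" "s / 2 < real u + 1"
    unfolding u_def using s(3) by linarith+
  define J where "J = u + m + 1"
  define K where "K = (p - m) div 2"
  have mp: "2 * m + 4 < p"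
  proof -
    have "2 * real m + 4 < real p" using s ss by linarith
    then show ?thesis by linarith
  qed
  have K1: "K > 0" "2 * (K - 1) + m < p" using mp by (auto simp: K_def)
  have u_p: "2 * u \<le> p"
  proof -
    have "2 * real u \<le> real p" using u s ss by linarith
    then show ?thesis by linarith
  qed
  have uu: "u * u + u \<le> K" "u > 0"
  proof -
    have "real u * real u \<le> (s / 2) * (s / 2)" using u(1) by (intro mult_mono) auto
    then have "real u * real u + real u \<le> real p / 4 + s / 2" using s(1) u(1) by simp
    also have "\<dots> \<le> (real p - real m - 1) / 2" using s(2,3) ps by (simp add: field_simps)
    also have "\<dots> \<le> real K"
    proof -
      have "p \<le> 2 * K + 1 + m" using mp by (auto simp: K_def)
      then have "real p \<le> 2 * real K + 1 + real m" by linarith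
      then show ?thesis by simp
    qed
    finally have "real (u * u + u) \<le> real K" by simp
    then show "u * u + u \<le> K" by linarith
    show "u > 0" using u s(3) by (auto intro!: gr0I)
  qed
  have tri: "2 * (\<Sum>i<n. i) + n = n * n" for n :: nat
    by (induction n) auto
  have "card S * (2 * u) \<le> (2 * u + c) * degree f + (K - 1) + (J - 1) * p"
  proof (rule stepanov_bound[OF p c f_eq f1 lead f0])
    show "S \<subseteq> {0..<int p}" by (auto simp: S_def)
    show "[poly f x ^ c = e] (mod int p)" if "x \<in> S" for x
    proof -
      from that have "Legendre (poly f x) (int p) = e"
        by (auto simp: S_def f_def poly_prod add.commute)
      moreover have "[Legendre (poly f x) (int p) = poly f x ^ ((p - 1) div 2)] (mod int p)"
        using p p121 by (intro euler_criterion) auto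
      ultimately show ?thesis by (simp add: c_def cong_sym)
    qed
    show "(\<Sum>i<2 * u. K + i * (degree f - 1) + J) < 2 * J * K"
    proof -
      have "(\<Sum>i<2 * u. K + i * (m - 1) + J) = 2 * u * (K + J) + (\<Sum>i<2 * u. i) * (m - 1)"
        by (simp only: sum.distrib sum_distrib_right[symmetric]) (simp add: distrib_left)
      also have "\<dots> \<le> 2 * u * (K + J) + (2 * u * u) * (m - 1)"
        using tri[of "2 * u"] by (intro add_left_mono mult_right_mono) auto
      also have "\<dots> = 2 * u * K + 2 * (u * u * m + u * (m + 1))"
        using m by (cases m) (auto simp: J_def algebra_simps)
      also have "\<dots> < 2 * u * K + 2 * ((m + 1) * (u * u + u))"
        using uu(2) by (simp add: algebra_simps)
      also have "\<dots> \<le> 2 * u * K + 2 * ((m + 1) * K)"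
        using uu(1) by (intro add_left_mono mult_left_mono) auto
      also have "\<dots> = 2 * J * K" by (simp add: J_def algebra_simps)
      finally show ?thesis by (simp add: deg)
    qed
  qed (use K1 u_p deg in \<open>auto simp: J_def\<close>)
  then have "card S * (2 * u) \<le> (2 * u + c) * m + (K - 1) + (u + m) * p"
    by (simp add: deg J_def)
  then have "real (card S * (2 * u)) \<le> real ((2 * u + c) * m + (K - 1) + (u + m) * p)"
    by (simp only: of_nat_le_iff)
  then have "real (card S) * (2 * real u) \<le> (2 * real u + real c) * real m + real (K - 1) + (real u + real m) * real p"
    by simp
  also have "\<dots> \<le> (2 * real u + real p / 2) * real m + real p / 2 + (real u + real m) * real p"
  proof -
    have "real c \<le> real p / 2" using c by simp
    moreover have "2 * (K - 1) \<le> p" using K1(2) by simp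
    then have "real (K - 1) \<le> real p / 2" by linarith
    ultimately show ?thesis by (intro add_mono mult_right_mono) auto
  qed
  also have "\<dots> = (2 * real u) * (real p / 2 + real m) + real p * (3 * real m + 1) / 2"
    by (simp add: field_simps)
  also have "real p * (3 * real m + 1) / 2 \<le> real p * (4 * real m) / 2"
    using m by (intro divide_right_mono mult_left_mono) auto
  also have "real p * (4 * real m) / 2 = s * (s * (2 * real m))"
    by (simp add: s(1)[symmetric])
  \<comment> \<open>From \<open>s / 2 < u + 1\<close> and \<open>s > 11\<close> one gets
    \<open>s \<le> (5 / 4) * (2 * u)\<close>.\<close>
  also have "s * (s * (2 * real m)) \<le> (2 * real u * (5 / 4)) * (s * (2 * real m))"
    using u s by (intro mult_right_mono) auto
  finally have "real (card S) * (2 * real u) \<le> (2 * real u) * (real p / 2 + real m + 5 / 2 * (s * real m))"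
    by (simp add: algebra_simps)
  then have "(2 * real u) * real (card S) \<le> (2 * real u) * (real p / 2 + real m + 5 / 2 * (s * real m))"
    by (simp add: mult.commute)
  then have "real (card S) \<le> real p / 2 + real m + 5 / 2 * (s * real m)"
    using uu(2) by (subst (asm) mult_le_cancel_left_pos) auto
  also have "\<dots> \<le> real p / 2 + 3 * real m * s"
  proof -
    have "2 * real m \<le> s * real m" using s(3) by (intro mult_right_mono) auto
    then show ?thesis by (simp add: algebra_simps)
  qed
  also have "card S = card {x \<in> {..<p}. Legendre (\<Prod>a\<in>I. int x + int a) (int p) = e}"
    unfolding S_def by (rule card_image) auto
  finally show ?thesis by (simp add: m_def s_def)
qed

text \<open>The sum is the difference of two level set sizes that add up to \<open>p\<close> minus
  at most \<open>card I\<close> zeros, so an upper bound for one is a lower bound for the other. If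
  \<open>11 * card I \<ge> sqrt p\<close>, the trivial bound \<open>p\<close> is good
  enough.\<close>

lemma Legendre_sum_bound:
  assumes p: "prime p" and I: "finite I" "I \<subseteq> {1..<p}" "I \<noteq> {}"
  shows "\<bar>\<Sum>x<p. real_of_int (Legendre (\<Prod>a\<in>I. int x + int a) (int p))\<bar>
           \<le> 11 * real (card I) * sqrt (real p)"
proof (cases "11 * real (card I) < sqrt (real p)")
  case False
  have "\<bar>\<Sum>x<p. real_of_int (Legendre (\<Prod>a\<in>I. int x + int a) (int p))\<bar> \<le>
      (\<Sum>x<p. \<bar>real_of_int (Legendre (\<Prod>a\<in>I. int x + int a) (int p))\<bar>)"
    by (rule sum_abs)
  also have "\<dots> \<le> (\<Sum>x<p. 1)"
  proof (rule sum_mono)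
    fix x
    show "\<bar>real_of_int (Legendre (\<Prod>a\<in>I. int x + int a) (int p))\<bar> \<le> 1"
      using Legendre_cases[of "\<Prod>a\<in>I. int x + int a" "int p"] by auto
  qed
  also have "\<dots> = sqrt (real p) * sqrt (real p)" by simp
  also have "\<dots> \<le> 11 * real (card I) * sqrt (real p)"
    using False by (intro mult_right_mono) auto
  finally show ?thesis .
next
  case True
  define L where "L = (\<lambda>x. Legendre (\<Prod>a\<in>I. int x + int a) (int p))"
  define N where "N = (\<lambda>e. real (card {x \<in> {..<p}. L x = e}))"
  define m where "m = card I"
  have p0: "p > 0" using p prime_gt_0_nat by blast
  have N_eq: "N e = (\<Sum>x<p. of_bool (L x = e))" for e
    by (simp add: N_def Int_def of_bool_def sum.If_cases)
  have bound: "N e \<le> real p / 2 + 3 * real m * sqrt (real p)" if "e \<in> {1, -1}" for e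
    unfolding N_def L_def m_def by (rule Legendre_level_set_bound[OF p I that True])
  have "{x \<in> {..<p}. L x = 0} = {x \<in> {..<p}. \<exists>a\<in>I. int p dvd int x + int a}"
    using p I(1) by (auto simp: L_def Legendre_eq_0_iff prime_dvd_prod_iff)
  then have N0: "N 0 \<le> real m"
    unfolding N_def m_def using card_zero_shift_le[OF I(1,2) p0] by simp
  have "N 1 + N (-1) + N 0 = (\<Sum>x<p. of_bool (L x = 1) + of_bool (L x = -1) + of_bool (L x = 0))"
    by (simp add: N_eq sum.distrib)
  also have "\<dots> = (\<Sum>x<p. 1)"
    using Legendre_cases by (intro sum.cong) (auto simp: L_def of_bool_def)
  finally have tot: "N 1 + N (-1) + N 0 = real p" by simp
  have diff: "(\<Sum>x<p. real_of_int (L x)) = N 1 - N (-1)"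
    unfolding N_eq sum_subtractf[symmetric]
    using Legendre_cases by (intro sum.cong) (auto simp: L_def of_bool_def)
  have "real m \<le> real m * sqrt (real p)"
    using p0 by (simp add: mult_le_cancel_left1)
  then show ?thesis
    using bound[of 1] bound[of "-1"] N0 tot diff unfolding L_def m_def by (simp add: algebra_simps)
qed

text \<open>\<open>W x / 2 ^ m\<close> is the indicator of the pattern, except at the at most
  \<open>m\<close> points where some symbol is 0. Expanding the product over subsets of
  \<open>I\<close>, the empty set gives \<open>p\<close> and every other one a character sum of size
  at most \<open>11 m sqrt p\<close>. After division by \<open>2 ^ m\<close> the two errors add up
  to the constant 12.\<close>

lemma Legendre_pattern_count:
  assumes p: "prime p" "p > 2" and I: "finite I" "I \<subseteq> {1..<p}" and e: "e \<in> {1, -1}"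
  shows "\<bar>real (card {x \<in> {..<p}. \<forall>a\<in>I. Legendre (int x + int a) (int p) = e}) - real p / 2 ^ card I\<bar>
           \<le> 12 * real (card I) * sqrt (real p)"
proof -
  define L where "L = (\<lambda>x a. real_of_int (Legendre (int x + int a) (int p)))"
  define d where "d = real_of_int e"
  define m where "m = card I"
  define G where "G = {x \<in> {..<p}. \<forall>a\<in>I. Legendre (int x + int a) (int p) = e}"
  define Z where "Z = {x \<in> {..<p}. \<exists>a\<in>I. int p dvd int x + int a}"
  define W where "W = (\<lambda>x. (\<Prod>a\<in>I. d * L x a + 1))"
  have d: "d = 1 \<or> d = -1" using e by (auto simp: d_def)
  have L: "L x a = 0 \<or> L x a = 1 \<or> L x a = -1" for x a
    using Legendre_cases[of "int x + int a" "int p"] by (auto simp: L_def)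
  have W01: "0 \<le> W x" "W x \<le> 2 ^ m" for x
  proof -
    have *: "0 \<le> d * L x a + 1 \<and> d * L x a + 1 \<le> 2" for a
      using d L[of x a] by auto
    then show "0 \<le> W x" unfolding W_def by (intro prod_nonneg) blast
    have "W x \<le> (\<Prod>a\<in>I. 2)" unfolding W_def
      using * by (intro prod_mono) blast
    then show "W x \<le> 2 ^ m" by (simp add: m_def)
  qed
  have close: "\<bar>of_bool (x \<in> G) - W x / 2 ^ m\<bar> \<le> of_bool (x \<in> Z)" if x: "x < p" for x
  proof (cases "x \<in> Z")
    case True
    then have "x \<notin> G"
      using e by (force simp: Z_def G_def Legendre_eq_0_iff[symmetric])
    then show ?thesis using True W01[of x] by simp
  next
    case False
    then have nz: "Legendre (int x + int a) (int p) \<noteq> 0" if "a \<in> I" for a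
      using that x by (auto simp: Z_def Legendre_eq_0_iff)
    show ?thesis
    proof (cases "x \<in> G")
      case True
      then have "W x = (\<Prod>a\<in>I. 2)"
        unfolding W_def using d by (intro prod.cong) (auto simp: G_def L_def d_def)
      then show ?thesis using True by (simp add: m_def)
    next
      case nG: False
      then obtain a where a: "a \<in> I" "Legendre (int x + int a) (int p) \<noteq> e"
        using x by (auto simp: G_def)
      then have "d * L x a + 1 = 0"
        using nz[OF a(1)] Legendre_cases[of "int x + int a" "int p"] e by (auto simp: d_def L_def)
      then have "W x = 0" unfolding W_def using a(1) I(1) by (intro prod_zero) auto
      then show ?thesis using nG by simp
    qed
  qed
  have "\<bar>(\<Sum>x<p. of_bool (x \<in> G) - W x / 2 ^ m)\<bar> \<le> (\<Sum>x<p. of_bool (x \<in> Z))"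
    using close by (intro order_trans[OF sum_abs] sum_mono) auto
  also have "\<dots> = real (card Z)"
    by (simp add: Z_def Int_def of_bool_def sum.If_cases conj_commute)
  also have "\<dots> \<le> real m"
    unfolding Z_def m_def using card_zero_shift_le[OF I] p by simp
  also have "(\<Sum>x<p. of_bool (x \<in> G) - W x / 2 ^ m) = real (card G) - (\<Sum>x<p. W x) / 2 ^ m"
    by (simp add: sum_subtractf sum_divide_distrib G_def Int_def of_bool_def sum.If_cases conj_commute)
  finally have A: "\<bar>real (card G) - (\<Sum>x<p. W x) / 2 ^ m\<bar> \<le> real m" .
  have W_exp: "W x = (\<Sum>T\<in>Pow I. d ^ card T * real_of_int (Legendre (\<Prod>a\<in>T. int x + int a) (int p)))" for x
  proof -
    have "W x = (\<Sum>T\<in>Pow I. (\<Prod>a\<in>T. d * L x a))"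
      unfolding W_def by (subst prod_add[OF I(1)]) simp
    also have "\<dots> = (\<Sum>T\<in>Pow I. d ^ card T * real_of_int (Legendre (\<Prod>a\<in>T. int x + int a) (int p)))"
      by (simp add: prod.distrib Legendre_prod[OF p] L_def)
    finally show ?thesis .
  qed
  have "(\<Sum>x<p. W x) = (\<Sum>T\<in>Pow I. d ^ card T * (\<Sum>x<p. real_of_int (Legendre (\<Prod>a\<in>T. int x + int a) (int p))))"
    unfolding W_exp by (subst sum.swap) (simp add: sum_distrib_left)
  also have "\<dots> = real p + (\<Sum>T\<in>Pow I - {{}}. d ^ card T * (\<Sum>x<p. real_of_int (Legendre (\<Prod>a\<in>T. int x + int a) (int p))))"
    using I(1) p by (subst sum.remove[of _ "{}"]) (auto simp: Legendre_1)
  finally have "\<bar>(\<Sum>x<p. W x) - real p\<bar> =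
      \<bar>\<Sum>T\<in>Pow I - {{}}. d ^ card T * (\<Sum>x<p. real_of_int (Legendre (\<Prod>a\<in>T. int x + int a) (int p)))\<bar>"
    by simp
  also have "\<dots> \<le> (\<Sum>T\<in>Pow I - {{}}. 11 * real m * sqrt (real p))"
  proof (intro order_trans[OF sum_abs] sum_mono)
    fix T assume T: "T \<in> Pow I - {{}}"
    have "\<bar>d ^ card T\<bar> = 1" using d by (auto simp: power_abs)
    then have "\<bar>d ^ card T * (\<Sum>x<p. real_of_int (Legendre (\<Prod>a\<in>T. int x + int a) (int p)))\<bar> =
        \<bar>\<Sum>x<p. real_of_int (Legendre (\<Prod>a\<in>T. int x + int a) (int p))\<bar>"
      by (simp add: abs_mult)
    also have "\<dots> \<le> 11 * real (card T) * sqrt (real p)"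
      using T I by (intro Legendre_sum_bound p) (auto intro: finite_subset)
    also have "\<dots> \<le> 11 * real m * sqrt (real p)"
      using T I by (intro mult_right_mono mult_left_mono) (auto simp: m_def card_mono)
    finally show "\<bar>d ^ card T * (\<Sum>x<p. real_of_int (Legendre (\<Prod>a\<in>T. int x + int a) (int p)))\<bar>
        \<le> 11 * real m * sqrt (real p)" .
  qed
  also have "\<dots> = real (card (Pow I - {{}})) * (11 * real m * sqrt (real p))" by simp
  also have "\<dots> \<le> 2 ^ m * (11 * real m * sqrt (real p))"
  proof (rule mult_right_mono)
    have "card (Pow I - {{}}) \<le> 2 ^ m"
      using card_mono[of "Pow I" "Pow I - {{}}"] I(1) by (auto simp: card_Pow m_def)
    then show "real (card (Pow I - {{}})) \<le> 2 ^ m" by (metis of_nat_le_iff of_nat_numeral of_nat_power)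
  qed simp
  finally have "\<bar>(\<Sum>x<p. W x) - real p\<bar> / 2 ^ m \<le> 11 * real m * sqrt (real p)"
    by (simp add: pos_divide_le_eq mult.commute)
  then have B: "\<bar>(\<Sum>x<p. W x) / 2 ^ m - real p / 2 ^ m\<bar> \<le> 11 * real m * sqrt (real p)"
    by (simp add: abs_divide diff_divide_distrib[symmetric])
  have "real m \<le> real m * sqrt (real p)"
    using p by (simp add: mult_le_cancel_left1)
  then show ?thesis using A B unfolding G_def m_def by linarith
qed

section \<open>Intervals of constant Legendre symbol\<close>

text \<open>For such a \<open>y = (z + t * p) div q\<close>, every \<open>q * (y + i)\<close> with
  \<open>i \<ge> 1\<close> and \<open>q * i \<le> n\<close> lies in the translate by
  \<open>t * p\<close> of the interval \<open>z + 1, ..., z + n\<close>.\<close>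

definition dilated_starts :: "nat \<Rightarrow> nat \<Rightarrow> nat \<Rightarrow> nat set" where
  "dilated_starts p z q = (\<lambda>t. (z + t * p) div q) ` {..<q}"

lemma card_dilated_starts:
  assumes "0 < q" "q \<le> p"
  shows "card (dilated_starts p z q) = q"
proof -
  have "strict_mono (\<lambda>t. (z + t * p) div q)"
    unfolding strict_mono_Suc_iff
  proof
    fix t
    have "Suc ((z + t * p) div q) = (z + t * p + q) div q" using assms by simp
    also have "\<dots> \<le> (z + Suc t * p) div q" using assms by (intro div_le_mono) simp
    finally show "(z + t * p) div q < (z + Suc t * p) div q" by simp
  qed
  then have "inj_on (\<lambda>t. (z + t * p) div q) {..<q}"
    by (meson inj_on_subset strict_mono_imp_inj_on subset_UNIV)
  then show ?thesis unfolding dilated_starts_def by (simp add: card_image)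
qed

text \<open>A common start makes \<open>z * (q' - q) + p * (t * q' - t' * q)\<close> smaller than
  \<open>q * q'\<close> in absolute value. As \<open>2 * (q * q') \<le> p\<close>, the integer
  \<open>t * q' - t' * q\<close> is then the same for all coincidences, so
  \<open>t * (q' - q)\<close> is determined modulo \<open>q\<close>. Only its quotient by
  \<open>q\<close> remains free, and that takes at most \<open>q' - q\<close> values.\<close>

lemma card_dilated_starts_Int:
  assumes q: "0 < q" "q < q'" and big: "2 * (q * q') \<le> p"
  shows "card (dilated_starts p z q \<inter> dilated_starts p z q') \<le> q' - q"
proof -
  define d where "d = q' - q"
  define T where "T = {t \<in> {..<q}. (z + t * p) div q \<in> dilated_starts p z q'}"
  have near: "\<bar>int z * (int q' - int q) + int p * (int t * int q' - int t' * int q)\<bar> < int (q * q')"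
    if "(z + t * p) div q = (z + t' * p) div q'" for t t'
  proof -
    define y where "y = (z + t * p) div q"
    have 1: "q * y \<le> z + t * p" "z + t * p < q * y + q"
      using q(1) dividend_less_times_div[of q "z + t * p"] by (auto simp: y_def)
    have 2: "q' * y \<le> z + t' * p" "z + t' * p < q' * y + q'"
      using q that dividend_less_times_div[of q' "z + t' * p"] by (auto simp: y_def)
    have "q' * (q * y) \<le> q' * (z + t * p)" "q' * (z + t * p) < q' * (q * y + q)"
      "q * (q' * y) \<le> q * (z + t' * p)" "q * (z + t' * p) < q * (q' * y + q')"
      using 1 2 q by simp_all
    then have "int (q' * (q * y)) \<le> int (q' * (z + t * p))" "int (q' * (z + t * p)) < int (q' * (q * y + q))"
      "int (q * (q' * y)) \<le> int (q * (z + t' * p))" "int (q * (z + t' * p)) < int (q * (q' * y + q'))"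
      by (simp_all only: of_nat_less_iff of_nat_le_iff)
    then show ?thesis by (simp add: algebra_simps abs_less_iff)
  qed
  have inj: "inj_on (\<lambda>t. (t * d) div q) T"
  proof (rule inj_onI)
    fix t u assume t: "t \<in> T" and u: "u \<in> T" and eq: "(t * d) div q = (u * d) div q"
    obtain t' where t': "(z + t * p) div q = (z + t' * p) div q'"
      using t by (auto simp: T_def dilated_starts_def)
    obtain u' where u': "(z + u * p) div q = (z + u' * p) div q'"
      using u by (auto simp: T_def dilated_starts_def)
    define D where "D = (int t * int q' - int t' * int q) - (int u * int q' - int u' * int q)"
    have "\<bar>int p * D\<bar> < 2 * int (q * q')"
      using near[OF t'] near[OF u'] unfolding D_def by (simp add: algebra_simps abs_less_iff)
    also have "\<dots> \<le> int p" using big by linarith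
    finally have "\<bar>int p * D\<bar> < int p * 1" by simp
    then have "int p * \<bar>D\<bar> < int p * 1" by (simp only: abs_mult abs_of_nat)
    then have "\<bar>D\<bar> < 1" by (rule mult_left_less_imp_less) simp
    then have "D = 0" by simp
    moreover have "int q' = int d + int q" using q by (simp add: d_def)
    ultimately have "int t * int d - int u * int d = int q * ((int t' - int u') - (int t - int u))"
      by (simp add: D_def algebra_simps)
    then have "int q dvd int (t * d) - int (u * d)" by (metis dvd_triv_left of_nat_mult)
    then have "int (t * d) mod int q = int (u * d) mod int q" by (simp add: mod_eq_dvd_iff)
    then have "(t * d) mod q = (u * d) mod q" by (metis of_nat_eq_iff zmod_int)
    then have "t * d = u * d" using eq by (metis mult_div_mod_eq)
    then show "t = u" using q by (simp add: d_def)
  qed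
  have "dilated_starts p z q \<inter> dilated_starts p z q' \<subseteq> (\<lambda>t. (z + t * p) div q) ` T"
    by (auto simp: T_def dilated_starts_def)
  then have "card (dilated_starts p z q \<inter> dilated_starts p z q') \<le> card T"
    by (rule surj_card_le[rotated]) (simp add: T_def)
  also have "card T = card ((\<lambda>t. (t * d) div q) ` T)" using inj by (simp add: card_image)
  also have "\<dots> \<le> card {..<d}"
  proof (rule card_mono)
    show "(\<lambda>t. (t * d) div q) ` T \<subseteq> {..<d}"
      using q by (auto simp: T_def d_def div_less_iff_less_mult mult.commute)
  qed simp
  finally show ?thesis by (simp add: d_def)
qed

text \<open>Each new set has more than \<open>Q\<close> starts and shares at most \<open>K\<close>
  with each of fewer than \<open>K\<close> earlier sets. The bound is stated over the integers since
  \<open>Q - K\<^sup>2\<close> may be negative.\<close>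

lemma card_UN_dilated_starts:
  assumes "k \<le> K" "0 < Q" "K \<le> Q" "8 * Q\<^sup>2 \<le> p"
  shows "int k * (int Q - (int K)\<^sup>2) \<le> int (card (\<Union>q\<in>{Q<..Q + k}. dilated_starts p z q))"
  using assms(1)
proof (induction k)
  case (Suc k)
  let ?Y = "dilated_starts p z"
  let ?q = "Q + Suc k"
  have le: "?q \<le> 2 * Q" using Suc.prems assms by simp
  have "Q * 1 \<le> Q * Q" using assms(2) by (intro mult_left_mono) auto
  then have qp: "?q \<le> p" using le assms(4) unfolding power2_eq_square by linarith
  have fin: "finite (?Y q)" for q by (simp add: dilated_starts_def)
  have "{Q<..Q + Suc k} = insert ?q {Q<..Q + k}" by auto
  then have "(\<Union>q\<in>{Q<..Q + Suc k}. ?Y q) = (\<Union>q\<in>{Q<..Q + k}. ?Y q) \<union> ?Y ?q" by auto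
  then have "card (\<Union>q\<in>{Q<..Q + Suc k}. ?Y q) + card ((\<Union>q\<in>{Q<..Q + k}. ?Y q) \<inter> ?Y ?q) =
      card (\<Union>q\<in>{Q<..Q + k}. ?Y q) + card (?Y ?q)"
    using card_Un_Int[of "\<Union>q\<in>{Q<..Q + k}. ?Y q" "?Y ?q"] fin by simp
  moreover have "card (?Y ?q) = ?q" using qp by (intro card_dilated_starts) auto
  moreover have "card ((\<Union>q\<in>{Q<..Q + k}. ?Y q) \<inter> ?Y ?q) \<le> K\<^sup>2"
  proof -
    have "card ((\<Union>q\<in>{Q<..Q + k}. ?Y q) \<inter> ?Y ?q) = card (\<Union>q\<in>{Q<..Q + k}. ?Y q \<inter> ?Y ?q)"
      by (rule arg_cong[of _ _ card]) auto
    also have "\<dots> \<le> (\<Sum>q\<in>{Q<..Q + k}. card (?Y q \<inter> ?Y ?q))"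
      by (rule card_UN_le) simp
    also have "\<dots> \<le> (\<Sum>q\<in>{Q<..Q + k}. K)"
    proof (rule sum_mono)
      fix q assume q: "q \<in> {Q<..Q + k}"
      have "q * ?q \<le> (2 * Q) * (2 * Q)" using q le by (intro mult_mono) auto
      then have "2 * (q * ?q) \<le> p" using assms(4) by (simp add: power2_eq_square)
      then have "card (?Y q \<inter> ?Y ?q) \<le> ?q - q" using q by (intro card_dilated_starts_Int) auto
      also have "\<dots> \<le> K" using q Suc.prems by auto
      finally show "card (?Y q \<inter> ?Y ?q) \<le> K" .
    qed
    also have "\<dots> \<le> K\<^sup>2" using Suc.prems by (simp add: power2_eq_square)
    finally show ?thesis .
  qed
  ultimately have "int (card (\<Union>q\<in>{Q<..Q + k}. ?Y q)) + int ?q \<le>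
      int (card (\<Union>q\<in>{Q<..Q + Suc k}. ?Y q)) + int (K\<^sup>2)"
    by linarith
  moreover have "int k * (int Q - (int K)\<^sup>2) \<le> int (card (\<Union>q\<in>{Q<..Q + k}. ?Y q))"
    using Suc by simp
  moreover have "int (Suc k) * (int Q - (int K)\<^sup>2) = int k * (int Q - (int K)\<^sup>2) + int Q - int (K\<^sup>2)"
    by (simp add: algebra_simps)
  ultimately show ?case by linarith
qed simp

text \<open>
  Burgess' dilation trick: if the Legendre symbol is constant on a long interval, then
  it is also constant on the shorter intervals obtained by dividing the translates
  by \<open>t p\<close> of the interval by \<open>q\<close>, and these have many different starting points.
\<close>

lemma Legendre_run_bound:
  assumes p: "prime p" "p > 2" and Q: "0 < Q" "K \<le> Q" "8 * Q\<^sup>2 \<le> p" and h: "h < p" "2 * Q * h \<le> n"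
    and e: "e \<in> {1, -1}" and run: "\<And>i. i \<in> {1..n} \<Longrightarrow> Legendre (int z + int i) (int p) = e"
  shows "real K * (real Q - (real K)\<^sup>2) \<le> 2 * (real p / 2 ^ h + 12 * real h * sqrt (real p))"
proof -
  \<comment> \<open>Reducing the left end modulo \<open>p\<close> keeps all dilated starts below
    \<open>p\<close>, where \<open>Legendre_pattern_count\<close> can count them.\<close>
  define w where "w = z mod p"
  have w: "w < p" using p by (simp add: w_def)
  have run': "Legendre (int (w + t * p + i)) (int p) = e" if "i \<in> {1..n}" for i t
  proof -
    have "[w + t * p = z] (mod p)" by (simp add: w_def Cong.cong_def)
    then have "[int (w + t * p + i) = int z + int i] (mod int p)"
      by (metis cong_add_rcancel cong_int_iff of_nat_add)
    then show ?thesis using run[OF that] Legendre_cong by metis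
  qed
  define G where "G = (\<lambda>d. {x \<in> {..<p}. \<forall>i\<in>{1..h}. Legendre (int x + int i) (int p) = d})"
  have sub: "dilated_starts p w q \<subseteq> G 1 \<union> G (-1)" if q: "q \<in> {Q<..Q + K}" for q
  proof
    fix y assume "y \<in> dilated_starts p w q"
    then obtain t where t: "t < q" "y = (w + t * p) div q" by (auto simp: dilated_starts_def)
    have "w + t * p < p + t * p" using w by simp
    also have "\<dots> = Suc t * p" by simp
    also have "\<dots> \<le> q * p" using t(1) by (intro mult_right_mono) auto
    finally have y: "y < p" using t q by (simp add: div_less_iff_less_mult mult.commute)
    have prod: "Legendre (int q) (int p) * Legendre (int y + int i) (int p) = e" if i: "i \<in> {1..h}" for i
    proof -
      have 1: "q * y \<le> w + t * p" "w + t * p < q * y + q"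
        using q dividend_less_times_div[of q "w + t * p"] by (auto simp: t(2))
      have "q * i \<le> 2 * Q * h" using q i Q by (intro mult_mono) auto
      then have "q * i \<le> n" using h by simp
      moreover have "q \<le> q * i" using i by simp
      moreover have "q * (y + i) = q * y + q * i" by (simp add: algebra_simps)
      ultimately have "q * (y + i) \<le> w + t * p + n" "q * (y + i) > w + t * p" using 1 by linarith+
      then obtain k where k: "q * (y + i) = w + t * p + k" "k \<in> {1..n}"
        by (metis add_diff_inverse_nat atLeastAtMost_iff diff_is_0_eq' less_imp_le_nat linorder_not_less
          nat_add_left_cancel_le not_less_eq_eq One_nat_def le_0_eq)
      have "Legendre (int q * (int y + int i)) (int p) = Legendre (int (w + t * p + k)) (int p)"
        using k(1) by (metis of_nat_add of_nat_mult)
      also have "\<dots> = e" by (rule run'[OF k(2)])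
      finally show ?thesis by (simp add: Legendre_mult[OF p])
    qed
    \<comment> \<open>The symbol on the short interval depends on \<open>q\<close> through this
      sign, hence the union of \<open>G 1\<close> and \<open>G (-1)\<close>. For
      \<open>h = 0\<close> there is no shift to show that \<open>q\<close> is prime to
      \<open>p\<close>, but then every \<open>y < p\<close> is in \<open>G\<close>.\<close>
    define d where "d = e * Legendre (int q) (int p)"
    show "y \<in> G 1 \<union> G (-1)"
    proof (cases "h = 0")
      case True
      then show ?thesis using y by (simp add: G_def)
    next
      case False
      then have "Legendre (int q) (int p) \<noteq> 0" using prod[of 1] e by auto
      then have q1: "Legendre (int q) (int p) = 1 \<or> Legendre (int q) (int p) = -1"
        using Legendre_cases by blast
      then have "d = 1 \<or> d = -1" using e by (auto simp: d_def)
      moreover have "y \<in> G d" unfolding G_def d_def using y prod q1 by fastforce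
      ultimately show ?thesis by auto
    qed
  qed
  have finG: "finite (G d)" for d by (simp add: G_def)
  have "int K * (int Q - (int K)\<^sup>2) \<le> int (card (\<Union>q\<in>{Q<..Q + K}. dilated_starts p w q))"
    by (rule card_UN_dilated_starts) (use Q in auto)
  also have "\<dots> \<le> int (card (G 1 \<union> G (-1)))"
    by (intro of_nat_mono card_mono finite_UnI finG UN_least sub)
  also have "\<dots> \<le> int (card (G 1) + card (G (-1)))"
    by (intro of_nat_mono card_Un_le)
  finally have "real_of_int (int K * (int Q - (int K)\<^sup>2)) \<le> real_of_int (int (card (G 1) + card (G (-1))))"
    by (simp only: of_int_le_iff)
  then have "real K * (real Q - (real K)\<^sup>2) \<le> real (card (G 1)) + real (card (G (-1)))" by simp
  moreover have "real (card (G d)) \<le> real p / 2 ^ h + 12 * real h * sqrt (real p)" if "d \<in> {1, -1}" for d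
  proof -
    have "{1..h} \<subseteq> {1..<p}" using h by auto
    from Legendre_pattern_count[OF p _ this that] show ?thesis by (simp add: G_def)
  qed
  from this[of 1] this[of "-1"] have "real (card (G 1)) + real (card (G (-1))) \<le>
    2 * (real p / 2 ^ h + 12 * real h * sqrt (real p))" by simp
  ultimately show ?thesis by linarith
qed

section \<open>Gaps of periodic sets\<close>

lemma bij_betw_mod_interval:
  assumes "0 < n"
  shows "bij_betw (\<lambda>y. y mod n) {a..<a + n} {..<n :: nat}"
proof -
  have inj: "inj_on (\<lambda>y. y mod n) {a..<a + n}"
  proof (rule linorder_inj_onI)
    fix x y assume "x < y" "x \<in> {a..<a + n}" "y \<in> {a..<a + n}"
    then have "0 < y - x" "y - x < n" by auto
    then have "\<not> n dvd y - x" using nat_dvd_not_less by blast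
    then show "x mod n \<noteq> y mod n"
      using \<open>x < y\<close> mod_eq_dvd_iff_nat[of x y n] by (metis less_imp_le_nat)
  qed auto
  moreover have "(\<lambda>y. y mod n) ` {a..<a + n} = {..<n}"
    by (rule card_subset_eq) (use assms inj in \<open>auto simp: card_image\<close>)
  ultimately show ?thesis by (simp add: bij_betw_def)
qed

text \<open>The increasing enumeration of the natural numbers whose residue lies in
  \<open>U\<close>. Unrolled in this way, every cyclic gap, the wrapping one included, is a
  difference of consecutive values.\<close>

definition cyclic_enum :: "nat \<Rightarrow> nat set \<Rightarrow> nat \<Rightarrow> nat" where
  "cyclic_enum n U i = sorted_list_of_set U ! (i mod card U) + n * (i div card U)"

locale cyclic_set =
  fixes n :: nat and U :: "nat set"
  assumes U: "U \<subseteq> {..<n}" "U \<noteq> {}"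
begin

abbreviation "r \<equiv> card U"
abbreviation "us \<equiv> sorted_list_of_set U"
abbreviation "s \<equiv> cyclic_gap n U"
abbreviation "e \<equiv> cyclic_enum n U"

lemma finite_U: "finite U" using U(1) by (rule finite_subset) simp
lemma r_pos: "r > 0" using finite_U U by (simp add: card_gt_0_iff)
lemma n_pos: "n > 0" using U by auto
lemma length_us: "length us = r" using finite_U by simp
lemma us_less: "j < r \<Longrightarrow> us ! j < n"
  using U finite_U nth_mem[of j us] by (auto simp: subset_iff)

lemma us_mono: "i < j \<Longrightarrow> j < r \<Longrightarrow> us ! i < us ! j"
  using sorted_wrt_nth_less[OF strict_sorted_list_of_set, of i j] by simp

lemma in_U_iff: "y \<in> U \<longleftrightarrow> (\<exists>j<r. y = us ! j)"
  using finite_U by (metis in_set_conv_nth length_us set_sorted_list_of_set)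

lemma cyclic_step:
  obtains (inner) "Suc i mod r = Suc (i mod r)" "Suc i div r = i div r" "Suc (i mod r) < r"
  | (wrap) "Suc i mod r = 0" "Suc i div r = Suc (i div r)" "Suc (i mod r) = r"
proof (cases "Suc (i mod r) < r")
  case True
  then show ?thesis using inner by (simp add: mod_Suc div_Suc)
next
  case False
  then have "Suc (i mod r) = r" using mod_less_divisor[OF r_pos, of i] by simp
  then show ?thesis using wrap by (simp add: mod_Suc div_Suc)
qed

lemma cyclic_enum_Suc: "e (Suc i) = e i + s i" and cyclic_gap_pos: "s i > 0"
proof -
  have *: "e (Suc i) = e i + s i \<and> s i > 0"
  proof (cases rule: cyclic_step[of i])
    case inner
    then have "us ! (i mod r) < us ! Suc (i mod r)" by (intro us_mono) auto
    then show ?thesis using inner by (simp add: cyclic_enum_def cyclic_gap_def Let_def)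
  next
    case wrap
    have "us ! (i mod r) < n" using r_pos by (intro us_less) simp
    then show ?thesis using wrap by (simp add: cyclic_enum_def cyclic_gap_def Let_def)
  qed
  then show "e (Suc i) = e i + s i" "s i > 0" by auto
qed

lemma cyclic_enum_mod_in: "e i mod n \<in> U"
proof -
  have j: "i mod r < r" using r_pos by simp
  then have "e i mod n = us ! (i mod r)" using us_less[OF j] by (simp add: cyclic_enum_def)
  then show ?thesis using j in_U_iff by blast
qed

lemma between_not_in:
  assumes "e i < x" "x < e (Suc i)"
  shows "x mod n \<notin> U"
proof
  assume "x mod n \<in> U"
  then obtain j where j: "j < r" "x mod n = us ! j" using in_U_iff by blast
  define d where "d = i div r"
  define y where "y = x - n * d"
  have us_le: "us ! a \<le> us ! b" if "a \<le> b" "b < r" for a b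
    using us_mono[of a b] that by (cases "a = b") auto
  have x: "x = y + n * d" "us ! (i mod r) < y"
    using assms(1) by (auto simp: y_def d_def cyclic_enum_def)
  have ym: "x mod n = y mod n" by (simp add: x(1))
  show False
  proof (cases rule: cyclic_step[of i])
    case inner
    then have y: "y < us ! Suc (i mod r)" using assms(2) x by (simp add: cyclic_enum_def d_def)
    also have "\<dots> < n" using inner by (intro us_less)
    finally have "y = us ! j" using j ym by simp
    then have "us ! (i mod r) < us ! j" "us ! j < us ! Suc (i mod r)" using x y by auto
    moreover have "j \<le> i mod r \<or> Suc (i mod r) \<le> j" by auto
    ultimately show False using us_le[of j "i mod r"] us_le[of "Suc (i mod r)" j] j(1) inner by force
  next
    case wrap
    then have y: "y < us ! 0 + n" using assms(2) x by (simp add: cyclic_enum_def d_def algebra_simps)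
    have u0: "us ! 0 < n" using r_pos by (intro us_less)
    show False
    \<comment> \<open>The wrapping gap runs past \<open>n\<close>: its part below \<open>n\<close>
      lies beyond the last element, the rest before the first.\<close>
    proof (cases "y < n")
      case True
      then have "us ! (i mod r) < us ! j" using j ym x by simp
      then show False using us_le[of j "i mod r"] j(1) wrap by force
    next
      case False
      then have "y mod n = y - n" using y u0 by (simp add: mod_if)
      then have "us ! j < us ! 0" using j ym y False by simp
      then show False using us_le[of 0 j] j(1) by simp
    qed
  qed
qed

lemma cyclic_enum_period: "e (i + r) = e i + n"
  using r_pos by (simp add: cyclic_enum_def)

lemma cyclic_gap_period: "s (i + r) = s i"
  by (simp add: cyclic_gap_def)

lemma sum_by_gaps:
  fixes g :: "nat \<Rightarrow> real"
  assumes "\<And>x. g (x + n) = g x"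
  shows "(\<Sum>x<n. g x) = (\<Sum>i<r. \<Sum>x\<in>{e i..<e (Suc i)}. g x)"
proof -
  have per: "g (x mod n) = g x" for x
  proof -
    have "g (y + m * n) = g y" for y m
    proof (induction m)
      case (Suc m)
      have "y + Suc m * n = (y + m * n) + n" by simp
      then show ?case using Suc assms by (simp only:)
    qed simp
    from this[of "x mod n" "x div n"] show ?thesis by simp
  qed
  have "(\<Sum>i<j. \<Sum>x\<in>{e i..<e (Suc i)}. g x) = (\<Sum>x\<in>{e 0..<e j}. g x)" for j
  proof (induction j)
    case (Suc j)
    have "e 0 \<le> e j" by (induction j) (auto simp: cyclic_enum_Suc)
    then show ?case using Suc by (simp add: sum.atLeastLessThan_concat cyclic_enum_Suc)
  qed simp
  then have "(\<Sum>i<r. \<Sum>x\<in>{e i..<e (Suc i)}. g x) = (\<Sum>x\<in>{e 0..<e 0 + n}. g x)"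
    using cyclic_enum_period[of 0] by simp
  also have "\<dots> = (\<Sum>x\<in>{e 0..<e 0 + n}. g (x mod n))" by (simp add: per)
  also have "\<dots> = (\<Sum>x<n. g x)"
    by (rule sum.reindex_bij_betw[OF bij_betw_mod_interval[OF n_pos]])
  finally show ?thesis by simp
qed

lemma sum_gaps: "(\<Sum>i<r. real (s i)) = real n"
  using sum_by_gaps[of "\<lambda>_. 1"] by (simp add: cyclic_enum_Suc)

text \<open>
  For \<open>t = 0\<close>, \<open>damped_reach t x\<close> is the distance from \<open>x\<close> to the next element of the periodic set.  For
  \<open>t = 1/2\<close>, up to the factor \<open>1 - t\<^sup>r\<close> that completes the geometric series over all periods, it is
  the expected distance if each element is kept independently with probability \<open>1/2\<close>.
\<close>

definition damping :: "real \<Rightarrow> nat \<Rightarrow> real" where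
  "damping t y = (if y mod n \<in> U then t else 1)"

definition damped_reach :: "real \<Rightarrow> nat \<Rightarrow> real" where
  "damped_reach t x = (\<Sum>h<n. \<Prod>i\<in>{1..h}. damping t (x + i))"

section \<open>Recursions and closed forms for the damped reach\<close>

lemma prod_damping_period: "(\<Prod>i\<in>{1..n}. damping t (x + i)) = t ^ r"
proof -
  have "(\<Prod>i\<in>{1..n}. damping t (x + i)) = (\<Prod>y\<in>{Suc x..<Suc x + n}. damping t y)"
    by (rule prod.reindex_bij_witness[of _ "\<lambda>y. y - x" "\<lambda>i. x + i"]) auto
  also have "\<dots> = (\<Prod>y\<in>{Suc x..<Suc x + n}. damping t (y mod n))" by (simp add: damping_def)
  also have "\<dots> = (\<Prod>y<n. damping t y)"
    by (rule prod.reindex_bij_betw[OF bij_betw_mod_interval[OF n_pos]])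
  also have "\<dots> = (\<Prod>y\<in>U. damping t y) * (\<Prod>y\<in>{..<n} - U. damping t y)"
    using U(1) by (subst prod.subset_diff[of U]) auto
  also have "(\<Prod>y\<in>{..<n} - U. damping t y) = 1"
    by (rule prod.neutral) (auto simp: damping_def)
  also have "(\<Prod>y\<in>U. damping t y) = (\<Prod>y\<in>U. t)"
    using U(1) by (intro prod.cong) (auto simp: damping_def)
  finally show ?thesis by simp
qed

lemma damped_reach_period: "damped_reach t (x + n) = damped_reach t x"
proof -
  have "damping t (x + n + i) = damping t (x + i)" for i
  proof -
    have "x + n + i = (x + i) + n" by simp
    then show ?thesis unfolding damping_def by (simp only: mod_add_self2)
  qed
  then show ?thesis by (simp add: damped_reach_def)
qed

lemma prod_damping_Suc:
  "(\<Prod>i\<in>{1..Suc h}. damping t (x + i)) = damping t (Suc x) * (\<Prod>i\<in>{1..h}. damping t (Suc x + i))"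
proof -
  have "(\<Prod>i\<in>{1..Suc h}. damping t (x + i)) = damping t (x + 1) * (\<Prod>i\<in>{Suc 1..Suc h}. damping t (x + i))"
    by (rule prod.atLeast_Suc_atMost) simp
  also have "(\<Prod>i\<in>{Suc 1..Suc h}. damping t (x + i)) = (\<Prod>i\<in>{1..h}. damping t (x + Suc i))"
    by (rule prod.shift_bounds_cl_Suc_ivl)
  finally show ?thesis by simp
qed

text \<open>Shift the window by one: the term \<open>h = 0\<close> contributes 1, the others are
  \<open>damping t (Suc x)\<close> times shorter windows from \<open>Suc x\<close>. The window of
  length \<open>n - 1\<close> from \<open>Suc x\<close> has no counterpart; with its factor it is a
  full period \<open>t ^ r\<close>, which is subtracted.\<close>

lemma damped_reach_step:
  "damped_reach t x = (1 - t ^ r) + damping t (Suc x) * damped_reach t (Suc x)"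
proof -
  obtain n' where n': "n = Suc n'" using n_pos by (cases n) auto
  define P where "P = (\<lambda>x h. \<Prod>i\<in>{1..h}. damping t (x + i))"
  have P: "P x (Suc h) = damping t (Suc x) * P (Suc x) h" for h
    unfolding P_def by (rule prod_damping_Suc)
  have D: "damped_reach t y = (\<Sum>h<Suc n'. P y h)" for y
    unfolding damped_reach_def P_def n'[symmetric] ..
  have "damped_reach t x = (\<Sum>h<Suc n'. P x h)" by (rule D)
  also have "\<dots> = P x 0 + (\<Sum>h<n'. P x (Suc h))" by (rule sum.lessThan_Suc_shift)
  also have "P x 0 = 1" by (simp add: P_def)
  also have "(\<Sum>h<n'. P x (Suc h)) = damping t (Suc x) * (\<Sum>h<n'. P (Suc x) h)"
    by (simp only: P sum_distrib_left)
  also have "(\<Sum>h<n'. P (Suc x) h) = damped_reach t (Suc x) - P (Suc x) n'"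
    by (simp add: D)
  finally have "damped_reach t x = 1 + damping t (Suc x) * damped_reach t (Suc x) - P x (Suc n')"
    by (simp add: P algebra_simps)
  moreover have "P x (Suc n') = t ^ r" using prod_damping_period[of t x] unfolding P_def n'[symmetric] .
  ultimately show ?thesis by simp
qed

text \<open>Going backwards from the next element: crossing it costs a factor \<open>t\<close>, and
  each step adds \<open>1 - t ^ r\<close>.\<close>

lemma damped_reach_within_gap:
  assumes "1 \<le> d" "d \<le> s i"
  shows "damped_reach t (e (Suc i) - d) = real d * (1 - t ^ r) + t * damped_reach t (e (Suc i))"
  using assms
proof (induction d rule: nat_induct_at_least)
  case base
  have "Suc (e (Suc i) - 1) = e (Suc i)" using cyclic_gap_pos[of i] by (simp add: cyclic_enum_Suc)
  then show ?case
    using damped_reach_step[of t "e (Suc i) - 1"] cyclic_enum_mod_in[of "Suc i"]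
    by (simp add: damping_def)
next
  case (Suc d)
  have x: "Suc (e (Suc i) - Suc d) = e (Suc i) - d"
    using Suc.prems by (simp add: cyclic_enum_Suc)
  have "(e (Suc i) - d) mod n \<notin> U"
    using Suc by (intro between_not_in[of i]) (auto simp: cyclic_enum_Suc)
  then have "damping t (e (Suc i) - d) = 1" by (simp add: damping_def)
  then show ?case
    using damped_reach_step[of t "e (Suc i) - Suc d"] Suc unfolding x by (simp add: algebra_simps)
qed

lemma damped_reach_enum: "damped_reach t (e i) = real (s i) * (1 - t ^ r) + t * damped_reach t (e (Suc i))"
  using damped_reach_within_gap[of "s i" i t] cyclic_gap_pos[of i] by (simp add: cyclic_enum_Suc)

text \<open>Iterating over one whole period leads back to the same value; the resulting linear
  equation is solvable since \<open>t ^ r < 1\<close>.\<close>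

lemma damped_reach_enum_eq:
  assumes "0 \<le> t" "t < 1"
  shows "damped_reach t (e i) = (\<Sum>j<r. t ^ j * real (s (i + j)))"
proof -
  have "damped_reach t (e i) = (1 - t ^ r) * (\<Sum>j<m. t ^ j * real (s (i + j))) + t ^ m * damped_reach t (e (i + m))" for m
  proof (induction m)
    case (Suc m)
    then show ?case using damped_reach_enum[of t "i + m"] by (simp add: algebra_simps)
  qed simp
  moreover have "damped_reach t (e (i + r)) = damped_reach t (e i)"
    by (simp add: cyclic_enum_period damped_reach_period)
  ultimately have "damped_reach t (e i) =
      (1 - t ^ r) * (\<Sum>j<r. t ^ j * real (s (i + j))) + t ^ r * damped_reach t (e i)"
    by metis
  then have "(1 - t ^ r) * damped_reach t (e i) = (1 - t ^ r) * (\<Sum>j<r. t ^ j * real (s (i + j)))"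
    by (simp add: algebra_simps)
  moreover have "t ^ r < 1" using assms r_pos by (simp add: power_less_one_iff)
  ultimately show ?thesis by simp
qed

lemma sum_damped_reach:
  "(\<Sum>x<n. damped_reach t x) =
     (\<Sum>i<r. (1 - t ^ r) * (real (s i) * (real (s i) + 1) / 2) + t * real (s i) * damped_reach t (e (Suc i)))"
proof -
  have tri: "(\<Sum>d\<in>{1..m}. real d) = real m * (real m + 1) / 2" for m
    by (induction m) (auto simp: field_simps)
  have "(\<Sum>x\<in>{e i..<e (Suc i)}. damped_reach t x) =
      (1 - t ^ r) * (real (s i) * (real (s i) + 1) / 2) + t * real (s i) * damped_reach t (e (Suc i))" for i
  proof -
    have "(\<Sum>x\<in>{e i..<e (Suc i)}. damped_reach t x) = (\<Sum>d\<in>{1..s i}. damped_reach t (e (Suc i) - d))"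
      by (rule sum.reindex_bij_witness[of _ "\<lambda>d. e (Suc i) - d" "\<lambda>x. e (Suc i) - x"])
         (auto simp: cyclic_enum_Suc)
    also have "\<dots> = (\<Sum>d\<in>{1..s i}. real d * (1 - t ^ r) + t * damped_reach t (e (Suc i)))"
      by (intro sum.cong refl damped_reach_within_gap) auto
    also have "\<dots> = (\<Sum>d\<in>{1..s i}. real d) * (1 - t ^ r) + t * real (s i) * damped_reach t (e (Suc i))"
      by (simp add: sum.distrib sum_distrib_right)
    finally show ?thesis by (simp only: tri mult.commute)
  qed
  then show ?thesis
    using sum_by_gaps[of "damped_reach t"] by (simp add: damped_reach_period)
qed

lemma prod_damping_add_period:
  "(\<Prod>i\<in>{1..n * T + h}. damping t (x + i)) = t ^ (r * T) * (\<Prod>i\<in>{1..h}. damping t (x + i))"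
proof (induction T)
  case (Suc T)
  define m where "m = n * T + h"
  have "(\<Prod>i\<in>{1..m + n}. damping t (x + i)) =
      (\<Prod>i\<in>{1..m}. damping t (x + i)) * (\<Prod>i\<in>{m + 1..m + n}. damping t (x + i))"
    by (rule prod.ub_add_nat) simp
  also have "(\<Prod>i\<in>{m + 1..m + n}. damping t (x + i)) = (\<Prod>i\<in>{1..n}. damping t (x + m + i))"
    by (rule prod.reindex_bij_witness[of _ "\<lambda>i. m + i" "\<lambda>i. i - m"]) (auto simp: add.assoc)
  also have "\<dots> = t ^ r" by (rule prod_damping_period)
  finally show ?case using Suc unfolding m_def by (simp add: algebra_simps power_add)
qed simp

text \<open>Lengthening a window by a period multiplies its product by \<open>t ^ r\<close>, so the
  \<open>T\<close> blocks of lengths form a geometric series.\<close>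

lemma sum_prod_damping:
  "(1 - t ^ r) * (\<Sum>h<n * T. \<Prod>i\<in>{1..h}. damping t (x + i)) = (1 - t ^ (r * T)) * damped_reach t x"
proof (induction T)
  case (Suc T)
  have "(\<Sum>h<n * Suc T. \<Prod>i\<in>{1..h}. damping t (x + i)) =
      (\<Sum>h<n * T. \<Prod>i\<in>{1..h}. damping t (x + i)) + (\<Sum>h\<in>{n * T..<n * T + n}. \<Prod>i\<in>{1..h}. damping t (x + i))"
    using sum.atLeastLessThan_concat[of 0 "n * T" "n * T + n" "\<lambda>h. \<Prod>i\<in>{1..h}. damping t (x + i)"]
    by (simp add: lessThan_atLeast0 add.commute)
  also have "(\<Sum>h\<in>{n * T..<n * T + n}. \<Prod>i\<in>{1..h}. damping t (x + i)) =
      (\<Sum>h<n. \<Prod>i\<in>{1..n * T + h}. damping t (x + i))"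
    by (rule sum.reindex_bij_witness[of _ "\<lambda>h. n * T + h" "\<lambda>h. h - n * T"]) auto
  also have "\<dots> = t ^ (r * T) * damped_reach t x"
    by (simp only: prod_damping_add_period damped_reach_def sum_distrib_left)
  finally have "(1 - t ^ r) * (\<Sum>h<n * Suc T. \<Prod>i\<in>{1..h}. damping t (x + i)) =
      (1 - t ^ r) * (\<Sum>h<n * T. \<Prod>i\<in>{1..h}. damping t (x + i)) +
      (1 - t ^ r) * t ^ (r * T) * damped_reach t x"
    by (simp only: distrib_left mult.assoc)
  then show ?case unfolding Suc by (simp add: algebra_simps power_add)
qed simp

lemma prod_damping_bounds:
  assumes "0 \<le> t" "t \<le> 1"
  shows "0 \<le> (\<Prod>i\<in>{1..h}. damping t (x + i))" "(\<Prod>i\<in>{1..h}. damping t (x + i)) \<le> 1"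
  using assms by (auto simp: damping_def intro!: prod_nonneg prod_le_1)

lemma damped_reach_bounds:
  assumes "0 \<le> t" "t \<le> 1"
  shows "0 \<le> damped_reach t x" "damped_reach t x \<le> real n"
proof -
  show "0 \<le> damped_reach t x"
    unfolding damped_reach_def by (intro sum_nonneg prod_damping_bounds assms)
  have "damped_reach t x \<le> (\<Sum>h<n. 1)"
    unfolding damped_reach_def by (intro sum_mono prod_damping_bounds assms)
  then show "damped_reach t x \<le> real n" by simp
qed

text \<open>With \<open>t = 0\<close> the damping product is the indicator of a window that avoids
  \<open>U\<close>, and each gap contributes \<open>s * (s + 1) / 2\<close>. Doubling gives
  \<open>s\<^sup>2 + s\<close>, and the gaps add up to \<open>n\<close>.\<close>

lemma gap_square_sum_eq:
  "real (gap_square_sum n U) =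
     2 * (\<Sum>h<n. real (card {x \<in> {..<n}. \<forall>i\<in>{1..h}. (x + i) mod n \<notin> U})) - real n"
proof -
  have ind: "(\<Prod>i\<in>{1..h}. damping 0 (x + i)) = of_bool (\<forall>i\<in>{1..h}. (x + i) mod n \<notin> U)" for x h
    by (cases "\<forall>i\<in>{1..h}. (x + i) mod n \<notin> U") (auto simp: damping_def intro!: prod.neutral)
  have "(\<Sum>x<n. damped_reach 0 x) = (\<Sum>h<n. \<Sum>x<n. of_bool (\<forall>i\<in>{1..h}. (x + i) mod n \<notin> U))"
    unfolding damped_reach_def ind by (rule sum.swap)
  also have "\<dots> = (\<Sum>h<n. real (card {x \<in> {..<n}. \<forall>i\<in>{1..h}. (x + i) mod n \<notin> U}))"
    by (simp add: Int_def of_bool_def sum.If_cases)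
  finally have "(\<Sum>h<n. real (card {x \<in> {..<n}. \<forall>i\<in>{1..h}. (x + i) mod n \<notin> U})) =
      (\<Sum>i<r. real (s i) * (real (s i) + 1) / 2)"
    using sum_damped_reach[of 0] r_pos by (simp add: power_0_left)
  also have "2 * \<dots> = (\<Sum>i<r. (real (s i))\<^sup>2 + real (s i))"
    unfolding sum_distrib_left by (intro sum.cong) (auto simp: field_simps power2_eq_square)
  also have "\<dots> = real (gap_square_sum n U) + real n"
    by (simp add: sum.distrib sum_gaps gap_square_sum_def)
  finally show ?thesis by simp
qed

text \<open>At \<open>t = 1/2\<close> the doubling cancels the factor \<open>t\<close>, and what
  remains are the gap correlations that make up the beta coefficients.\<close>

lemma sum_damped_reach_half:
  "2 * (\<Sum>x<n. damped_reach (1/2) x) - (1 - (1/2) ^ r) * real n =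
     (1 - (1/2) ^ r) * (\<Sum>i<r. (real (s i))\<^sup>2) +
     (\<Sum>j<r. (1/2) ^ j * (\<Sum>i<r. real (s i) * real (s (i + Suc j))))"
proof -
  define q :: real where "q = 1 - (1/2) ^ r"
  have "2 * (\<Sum>x<n. damped_reach (1/2) x) =
      (\<Sum>i<r. q * ((real (s i))\<^sup>2 + real (s i)) + real (s i) * damped_reach (1/2) (e (Suc i)))"
    unfolding sum_damped_reach q_def[symmetric] sum_distrib_left
    by (intro sum.cong) (auto simp: field_simps power2_eq_square)
  also have "\<dots> = q * (\<Sum>i<r. (real (s i))\<^sup>2) + q * real n +
      (\<Sum>i<r. real (s i) * damped_reach (1/2) (e (Suc i)))"
    by (simp add: sum.distrib sum_distrib_left[symmetric] sum_gaps distrib_left)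
  also have "(\<Sum>i<r. real (s i) * damped_reach (1/2) (e (Suc i))) =
      (\<Sum>i<r. \<Sum>j<r. (1/2) ^ j * (real (s i) * real (s (i + Suc j))))"
    by (simp add: damped_reach_enum_eq sum_distrib_left algebra_simps)
  also have "\<dots> = (\<Sum>j<r. (1/2) ^ j * (\<Sum>i<r. real (s i) * real (s (i + Suc j))))"
    by (subst sum.swap) (simp add: sum_distrib_left)
  finally show ?thesis by (simp add: q_def)
qed

end

section \<open>Squares modulo a product\<close>

lemma squares_mod_iff:
  assumes "n > 0"
  shows "x mod n \<in> squares_mod n \<longleftrightarrow> (\<exists>a. [a\<^sup>2 = x] (mod n))"
proof
  assume "x mod n \<in> squares_mod n"
  then show "\<exists>a. [a\<^sup>2 = x] (mod n)" by (auto simp: squares_mod_def Cong.cong_def)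
next
  assume "\<exists>a. [a\<^sup>2 = x] (mod n)"
  then obtain a where "a\<^sup>2 mod n = x mod n" by (auto simp: Cong.cong_def)
  then have "x mod n = (a mod n)\<^sup>2 mod n" by (simp add: power_mod)
  moreover have "a mod n \<in> {..<n}" using assms by simp
  ultimately show "x mod n \<in> squares_mod n" unfolding squares_mod_def by (rule image_eqI)
qed

lemma zero_in_squares_mod: "n > 0 \<Longrightarrow> 0 \<in> squares_mod n"
  by (auto simp: squares_mod_def intro!: image_eqI[of _ _ 0])

lemma cyclic_set_squares_mod: "n > 0 \<Longrightarrow> cyclic_set n (squares_mod n)"
  using zero_in_squares_mod[of n] by unfold_locales (auto simp: squares_mod_def)

lemma squares_mod_mult_iff:
  assumes "coprime A p" "A > 0" "p > 0"
  shows "x mod (A * p) \<in> squares_mod (A * p) \<longleftrightarrow> x mod A \<in> squares_mod A \<and> x mod p \<in> squares_mod p"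
proof -
  have "(\<exists>c. [c\<^sup>2 = x] (mod (A * p))) \<longleftrightarrow> (\<exists>a. [a\<^sup>2 = x] (mod A)) \<and> (\<exists>b. [b\<^sup>2 = x] (mod p))"
  proof safe
    fix c assume "[c\<^sup>2 = x] (mod (A * p))"
    then show "\<exists>a. [a\<^sup>2 = x] (mod A)" "\<exists>b. [b\<^sup>2 = x] (mod p)"
      by (meson cong_modulus_mult cong_modulus_mult_nat cong_dvd_modulus_nat dvd_triv_left dvd_triv_right)+
  next
    fix a b assume ab: "[a\<^sup>2 = x] (mod A)" "[b\<^sup>2 = x] (mod p)"
    obtain c where c: "[c = a] (mod A)" "[c = b] (mod p)"
      using binary_chinese_remainder_nat[OF assms(1)] by blast
    have "[c\<^sup>2 = x] (mod A)" "[c\<^sup>2 = x] (mod p)"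
      using c ab by (meson cong_pow cong_trans)+
    then have "[c\<^sup>2 = x] (mod (A * p))" using assms(1) by (rule coprime_cong_mult_nat)
    then show "\<exists>c. [c\<^sup>2 = x] (mod (A * p))" by blast
  qed
  then show ?thesis using assms(2,3) by (simp add: squares_mod_iff)
qed

text \<open>Since 0 is a square, the symbol 0 falls on the side of the squares. The work lies in
  passing between integer and natural roots.\<close>

lemma not_square_mod_iff_Legendre:
  assumes "p > 0"
  shows "x mod p \<notin> squares_mod p \<longleftrightarrow> Legendre (int x) (int p) = -1"
proof -
  have "(\<exists>y. [y\<^sup>2 = int x] (mod int p)) \<longleftrightarrow> (\<exists>a. [a\<^sup>2 = x] (mod p))"
  proof
    assume "\<exists>y. [y\<^sup>2 = int x] (mod int p)"
    then obtain y where y: "[y\<^sup>2 = int x] (mod int p)" by blast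
    define a where "a = nat (y mod int p)"
    have "int a = y mod int p" using assms by (simp add: a_def)
    then have "[int a = y] (mod int p)" by (simp add: Cong.cong_def)
    then have "[int a ^ 2 = int x] (mod int p)" using y by (meson cong_pow cong_trans)
    then show "\<exists>a. [a\<^sup>2 = x] (mod p)" by (metis cong_int_iff of_nat_power)
  next
    assume "\<exists>a. [a\<^sup>2 = x] (mod p)"
    then show "\<exists>y. [y\<^sup>2 = int x] (mod int p)" by (metis cong_int_iff of_nat_power)
  qed
  moreover have "\<exists>a. [a\<^sup>2 = x] (mod p)" if "[int x = 0] (mod int p)"
  proof -
    have "p dvd x" using that by (simp add: cong_0_iff)
    then have "[0\<^sup>2 = x] (mod p)" by (simp add: Cong.cong_def)
    then show ?thesis by blast
  qed
  ultimately show ?thesis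
    unfolding squares_mod_iff[OF assms] Legendre_def QuadRes_def by auto
qed

text \<open>With \<open>C k\<close> for the gap correlations, \<open>F\<close> has coefficients
  \<open>C 0\<close> at both ends and \<open>2 * C k\<close> between, and
  \<open>Q(1/2) = 2 * q\<close>. Substituting \<open>k = j + 1\<close> in
  \<open>sum_damped_reach_half\<close>, the term \<open>k = r\<close> becomes
  \<open>2 * C 0 * (1/2) ^ r\<close>; together with \<open>q * C 0\<close> it gives both end terms
  of \<open>F\<close>.\<close>

lemma sum_damped_reach_squares_mod:
  fixes A :: nat
  defines "R \<equiv> squares_mod A"
  assumes A: "A > 0"
  shows "2 * ((\<Sum>x<A. cyclic_set.damped_reach A R (1/2) x) / (1 - (1/2) ^ card R)) - real A =
           2 * f_fun A (1/2)"
proof -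
  interpret cyclic_set A R unfolding R_def by (rule cyclic_set_squares_mod[OF A])
  define C where "C = (\<lambda>k. \<Sum>i<r. real (s i) * real (s (i + k)))"
  define q :: real where "q = 1 - (1/2) ^ r"
  have q: "q > 0" using r_pos by (simp add: q_def power_less_one_iff)
  have C_r: "C r = C 0" by (simp add: C_def cyclic_gap_period)
  have beta: "real (beta_coeff A k) = (if k = 0 \<or> k = r then C 0 else 2 * C k)" for k
    by (auto simp: beta_coeff_def Let_def C_def R_def power2_eq_square)
  have "F_fun A (1/2) = (\<Sum>k\<le>r. real (beta_coeff A k) * (1/2) ^ k)"
    by (simp add: F_fun_def R_def)
  also have "{..r} = insert 0 (insert r {1..<r})" using r_pos by auto
  also have "(\<Sum>k\<in>insert 0 (insert r {1..<r}). real (beta_coeff A k) * (1/2) ^ k) =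
      C 0 + (C 0 * (1/2) ^ r + (\<Sum>k\<in>{1..<r}. real (beta_coeff A k) * (1/2) ^ k))"
    using r_pos by (subst sum.insert, simp, simp, subst sum.insert) (simp_all add: beta)
  also have "(\<Sum>k\<in>{1..<r}. real (beta_coeff A k) * (1/2) ^ k) = (\<Sum>k\<in>{1..<r}. 2 * C k * (1/2) ^ k)"
    by (intro sum.cong) (auto simp: beta)
  finally have F: "F_fun A (1/2) = C 0 + C 0 * (1/2) ^ r + (\<Sum>k\<in>{1..<r}. 2 * C k * (1/2) ^ k)" by simp
  have Q: "Q_fun A (1/2) = 2 * q"
  proof -
    have "(\<Sum>k<m. (1/2) ^ k) = 2 * (1 - (1/2::real) ^ m)" for m by (induction m) auto
    then show ?thesis by (simp add: Q_fun_def q_def R_def)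
  qed
  have "(\<Sum>j<r. (1/2) ^ j * C (Suc j)) = (\<Sum>k\<in>{1..r}. 2 * C k * (1/2) ^ k)"
    by (rule sum.reindex_bij_witness[of _ "\<lambda>k. k - 1" Suc]) auto
  also have "{1..r} = insert r {1..<r}" using r_pos by auto
  finally have S: "(\<Sum>j<r. (1/2) ^ j * C (Suc j)) = 2 * C 0 * (1/2) ^ r + (\<Sum>k\<in>{1..<r}. 2 * C k * (1/2) ^ k)"
    by (simp add: C_r)
  have "2 * (\<Sum>x<A. damped_reach (1/2) x) - q * real A = q * C 0 + (\<Sum>j<r. (1/2) ^ j * C (Suc j))"
    using sum_damped_reach_half unfolding q_def C_def by (simp add: power2_eq_square)
  also have "\<dots> = F_fun A (1/2)" unfolding F S by (simp add: q_def algebra_simps)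
  finally have "(2 * (\<Sum>x<A. damped_reach (1/2) x) - q * real A) / q = F_fun A (1/2) / q" by simp
  then show ?thesis using q unfolding f_fun_def Q q_def[symmetric] by (simp add: diff_divide_distrib)
qed

section \<open>Counting by the Chinese remainder theorem\<close>

lemma bij_betw_residue_pair:
  assumes "coprime A p" "A > 0" "p > 0"
  shows "bij_betw (\<lambda>x. (x mod A, x mod p)) {..<A * p} ({..<A} \<times> {..<p :: nat})"
proof -
  have inj: "inj_on (\<lambda>x. (x mod A, x mod p)) {..<A * p}"
  proof (rule inj_onI)
    fix x y assume xy: "x \<in> {..<A * p}" "y \<in> {..<A * p}" "(x mod A, x mod p) = (y mod A, y mod p)"
    then have "[x = y] (mod A)" "[x = y] (mod p)" by (auto simp: Cong.cong_def)
    then have "[x = y] (mod (A * p))" using assms(1) by (rule coprime_cong_mult_nat)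
    then show "x = y" using xy by (simp add: Cong.cong_def)
  qed
  moreover have "(\<lambda>x. (x mod A, x mod p)) ` {..<A * p} = {..<A} \<times> {..<p}"
    by (rule card_subset_eq) (use assms inj in \<open>auto simp: card_image card_cartesian_product\<close>)
  ultimately show ?thesis by (simp add: bij_betw_def)
qed

text \<open>"Square free" in the name refers to windows that contain no square modulo
  \<open>A * p\<close>. A shift is constrained modulo \<open>p\<close> only if it hits a square
  modulo \<open>A\<close>.\<close>

lemma card_square_free_window:
  assumes cop: "coprime A p" "A > 0" "p > 0"
  shows "card {x \<in> {..<A * p}. \<forall>i\<in>{1..h}. (x + i) mod (A * p) \<notin> squares_mod (A * p)} =
    (\<Sum>a<A. card {y \<in> {..<p}. \<forall>i\<in>{i \<in> {1..h}. (a + i) mod A \<in> squares_mod A}.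
                    Legendre (int y + int i) (int p) = -1})"
    (is "card ?L = (\<Sum>a<A. card (?G a))")
proof -
  have "bij_betw (\<lambda>x. (x mod A, x mod p)) ?L ((\<lambda>x. (x mod A, x mod p)) ` ?L)"
    by (rule bij_betw_subset[OF bij_betw_residue_pair[OF cop]]) auto
  then have "card ?L = card ((\<lambda>x. (x mod A, x mod p)) ` ?L)" by (rule bij_betw_same_card)
  also have "(\<lambda>x. (x mod A, x mod p)) ` ?L = Sigma {..<A} ?G"
  proof -
    have char: "(\<forall>i\<in>{1..h}. (x + i) mod (A * p) \<notin> squares_mod (A * p)) \<longleftrightarrow> x mod p \<in> ?G (x mod A)" for x
    proof -
      have "(x + i) mod (A * p) \<notin> squares_mod (A * p) \<longleftrightarrow>
          ((x mod A + i) mod A \<in> squares_mod A \<longrightarrow> Legendre (int (x mod p) + int i) (int p) = -1)" for i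
        using squares_mod_mult_iff[OF cop, of "x + i"] not_square_mod_iff_Legendre[OF cop(3), of "x mod p + i"]
        by (simp add: mod_simps)
      then show ?thesis using cop(3) by auto
    qed
    have "(\<lambda>x. (x mod A, x mod p)) ` {..<A * p} = {..<A} \<times> {..<p}"
      using bij_betw_residue_pair[OF cop] by (simp add: bij_betw_def)
    note surj = this
    show ?thesis
    proof (intro equalityI subsetI)
      fix z assume "z \<in> (\<lambda>x. (x mod A, x mod p)) ` ?L"
      then obtain x where "z = (x mod A, x mod p)" "x \<in> ?L" by blast
      then show "z \<in> Sigma {..<A} ?G" using char[of x] cop(2) by simp
    next
      fix z assume "z \<in> Sigma {..<A} ?G"
      then obtain a y where z: "z = (a, y)" "a < A" "y \<in> ?G a" by blast
      then have "(a, y) \<in> (\<lambda>x. (x mod A, x mod p)) ` {..<A * p}" unfolding surj by simp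
      then obtain x where x: "x \<in> {..<A * p}" "a = x mod A" "y = x mod p" by blast
      then have "x \<in> ?L" using char[of x] z(3) by simp
      then show "z \<in> (\<lambda>x. (x mod A, x mod p)) ` ?L" using z(1) x by blast
    qed
  qed
  also have "card \<dots> = (\<Sum>a<A. card (?G a))" by simp
  finally show ?thesis .
qed

section \<open>The asymptotic formula\<close>

text \<open>Look only at the multiples of \<open>A\<close> among \<open>x + 1, ..., x + h\<close>.
  They are 0, a square, modulo \<open>A\<close>, so they must be nonresidues modulo
  \<open>p\<close>, and by multiplicativity the symbol of \<open>z + k\<close> is constantly
  \<open>- Legendre A p\<close> on a run of length \<open>2 * Q * T\<close>. The run bound for
  windows of length \<open>T\<close>, where \<open>p / 2 ^ T \<le> 1\<close>, contradicts the
  inequality on \<open>K\<close>.\<close>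

lemma nonresidue_gap_bound:
  assumes p: "prime p" "p > 2" and A: "A > 0" "coprime A p"
    and T: "p \<le> 2 ^ T" "T < p" and Q: "0 < Q" "K \<le> Q" "8 * Q\<^sup>2 \<le> p"
    and K: "2 * (1 + 12 * real T * sqrt (real p)) < real K * (real Q - (real K)\<^sup>2)"
    and h: "A * (2 * Q * T) \<le> h"
  shows "{x \<in> {..<A * p}. \<forall>i\<in>{1..h}. (x + i) mod (A * p) \<notin> squares_mod (A * p)} = {}"
proof (rule ccontr)
  assume "\<not> ?thesis"
  then obtain x where x: "\<And>i. i \<in> {1..h} \<Longrightarrow> (x + i) mod (A * p) \<notin> squares_mod (A * p)" by blast
  define z where "z = x div A"
  have p0: "p > 0" using p by simp
  have nd: "\<not> int p dvd int A"
    using p(1) A(2) by (metis int_dvd_int_iff coprime_commute not_prime_unit prime_imp_coprime_nat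
      coprime_absorb_left)
  have run: "Legendre (int z + int k) (int p) = - Legendre (int A) (int p)" if k: "k \<in> {1..2 * Q * T}" for k
  proof -
    have 1: "A * z \<le> x" "x < A * z + A"
      using A(1) dividend_less_times_div[of A x] by (auto simp: z_def)
    have "A * 1 \<le> A * k" "A * k \<le> A * (2 * Q * T)" using k by (intro mult_left_mono; simp)+
    then have 2: "A \<le> A * k" "A * k \<le> h" using h by linarith+
    define i where "i = A * (z + k) - x"
    have "A * (z + k) = A * z + A * k" by (rule distrib_left)
    then have "x < A * (z + k)" "A * (z + k) \<le> x + h" using 1 2 by linarith+
    then have i: "x + i = A * (z + k)" "i \<in> {1..h}" by (auto simp: i_def)
    have "(x + i) mod A \<in> squares_mod A" using zero_in_squares_mod[OF A(1)] by (simp add: i(1))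
    then have "(x + i) mod p \<notin> squares_mod p"
      using x[OF i(2)] squares_mod_mult_iff[OF A(2,1) p0] by blast
    then have "Legendre (int A * (int z + int k)) (int p) = -1"
      using not_square_mod_iff_Legendre[OF p0, of "x + i"] unfolding i(1) by simp
    then have "Legendre (int A) (int p) * Legendre (int z + int k) (int p) = -1"
      by (simp add: Legendre_mult[OF p])
    then show ?thesis
      using Legendre_cases[of "int A" "int p"] Legendre_cases[of "int z + int k" "int p"] by auto
  qed
  have "- Legendre (int A) (int p) \<in> {1, -1}"
    using nd Legendre_cases[of "int A" "int p"] by (auto simp: Legendre_eq_0_iff)
  then have "real K * (real Q - (real K)\<^sup>2) \<le> 2 * (real p / 2 ^ T + 12 * real T * sqrt (real p))"
    by (rule Legendre_run_bound[OF p Q T(2) order_refl _ run])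
  also have "\<dots> \<le> 2 * (1 + 12 * real T * sqrt (real p))"
    using of_nat_mono[OF T(1), where ?'a = real] by (intro mult_left_mono add_right_mono) auto
  finally show False using K by simp
qed

text \<open>At \<open>t = 1/2\<close> the damping product is \<open>1 / 2 ^ c\<close>, where
  \<open>c\<close> counts the shifts constrained modulo \<open>p\<close>, so this is the pattern
  count summed over \<open>a\<close>. The condition \<open>h < p\<close> keeps the shifts
  incongruent modulo \<open>p\<close>.\<close>

lemma square_free_window_count:
  fixes A p h :: nat
  defines "R \<equiv> squares_mod A"
  assumes p: "prime p" "p > 2" and A: "A > 0" "coprime A p" and h: "h < p"
  shows "\<bar>real (card {x \<in> {..<A * p}. \<forall>i\<in>{1..h}. (x + i) mod (A * p) \<notin> squares_mod (A * p)}) -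
           real p * (\<Sum>a<A. \<Prod>i\<in>{1..h}. cyclic_set.damping A R (1/2) (a + i))\<bar>
         \<le> 12 * real A * real h * sqrt (real p)"
proof -
  interpret cyclic_set A R unfolding R_def by (rule cyclic_set_squares_mod[OF A(1)])
  define I where "I = (\<lambda>a. {i \<in> {1..h}. (a + i) mod A \<in> R})"
  define G where "G = (\<lambda>a. {y \<in> {..<p}. \<forall>i\<in>I a. Legendre (int y + int i) (int p) = -1})"
  have p0: "p > 0" using p by simp
  have finI: "finite (I a)" for a by (simp add: I_def)
  have cardI: "card (I a) \<le> h" for a
  proof -
    have "card (I a) \<le> card {1..h}" by (rule card_mono) (auto simp: I_def)
    then show ?thesis by simp
  qed
  have P: "(\<Prod>i\<in>{1..h}. damping (1/2) (a + i)) = 1 / 2 ^ card (I a)" for a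
  proof -
    have "(\<Prod>i\<in>{1..h}. damping (1/2) (a + i)) = (\<Prod>i\<in>I a. damping (1/2) (a + i))"
      by (rule prod.mono_neutral_right) (auto simp: I_def damping_def)
    also have "\<dots> = (\<Prod>i\<in>I a. 1/2)" by (rule prod.cong) (auto simp: I_def damping_def)
    finally show ?thesis by (simp add: power_divide)
  qed
  have "real (card {x \<in> {..<A * p}. \<forall>i\<in>{1..h}. (x + i) mod (A * p) \<notin> squares_mod (A * p)}) =
      (\<Sum>a<A. real (card (G a)))"
    unfolding card_square_free_window[OF A(2,1) p0] G_def I_def R_def by simp
  moreover have "real p * (\<Sum>a<A. \<Prod>i\<in>{1..h}. damping (1/2) (a + i)) = (\<Sum>a<A. real p / 2 ^ card (I a))"
    unfolding P by (simp add: sum_distrib_left)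
  ultimately have "\<bar>real (card {x \<in> {..<A * p}. \<forall>i\<in>{1..h}. (x + i) mod (A * p) \<notin> squares_mod (A * p)}) -
           real p * (\<Sum>a<A. \<Prod>i\<in>{1..h}. damping (1/2) (a + i))\<bar> =
      \<bar>\<Sum>a<A. real (card (G a)) - real p / 2 ^ card (I a)\<bar>"
    by (simp add: sum_subtractf)
  also have "\<dots> \<le> (\<Sum>a<A. 12 * real h * sqrt (real p))"
  proof (intro order_trans[OF sum_abs] sum_mono)
    fix a
    have "I a \<subseteq> {1..<p}" using h by (auto simp: I_def)
    from Legendre_pattern_count[OF p finI this, of "-1"]
    have "\<bar>real (card (G a)) - real p / 2 ^ card (I a)\<bar> \<le> 12 * real (card (I a)) * sqrt (real p)"
      by (simp add: G_def)
    also have "\<dots> \<le> 12 * real h * sqrt (real p)"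
      using cardI[of a] by (intro mult_right_mono) auto
    finally show "\<bar>real (card (G a)) - real p / 2 ^ card (I a)\<bar> \<le> 12 * real h * sqrt (real p)" .
  qed
  finally show ?thesis by (simp add: algebra_simps)
qed

lemma gap_square_sum_estimate:
  assumes p: "prime p" "p > 2" and A: "A > 0" "coprime A p"
    and T: "p \<le> 2 ^ T" "A * T < p" and Q: "0 < Q" "K \<le> Q" "8 * Q\<^sup>2 \<le> p"
    and K: "2 * (1 + 12 * real T * sqrt (real p)) < real K * (real Q - (real K)\<^sup>2)"
  shows "\<bar>real (gap_square_sum (A * p) (squares_mod (A * p))) - 2 * f_fun A (1/2) * real p\<bar>
    \<le> real A ^ 3 * (24 * (real T)\<^sup>2 * sqrt (real p) + 4 + 4 * real Q * real T
                     + 48 * real Q * (real T)\<^sup>2 * sqrt (real p))"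
proof -
  define R where "R = squares_mod A"
  define M where "M = A * p"
  interpret cyclic_set A R unfolding R_def by (rule cyclic_set_squares_mod[OF A(1)])
  define P where "P = (\<lambda>h a. \<Prod>i\<in>{1..h}. damping (1/2) (a + i))"
  define D where "D = (\<lambda>h. \<Sum>a<A. P h a)"
  define NS where "NS = (\<lambda>h. {x \<in> {..<M}. \<forall>i\<in>{1..h}. (x + i) mod M \<notin> squares_mod M})"
  define N where "N = (\<lambda>h. real (card (NS h)))"
  define q :: real where "q = 1 - (1/2) ^ r"
  \<comment> \<open>\<open>W\<close> is the geometric series over all window lengths,
    \<open>\<epsilon>\<close> the proportion lost by stopping after \<open>T\<close> periods of the
    squares modulo \<open>A\<close>, that is at \<open>H\<close>. From \<open>L\<close> on, no
    window avoids the squares modulo \<open>M\<close>.\<close>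
  define \<epsilon> :: real where "\<epsilon> = (1/2) ^ (r * T)"
  define W where "W = (\<Sum>a<A. damped_reach (1/2) a) / q"
  define H where "H = A * T"
  define L where "L = A * (2 * Q * T)"
  define sp where "sp = sqrt (real p)"
  have A1: "real A \<ge> 1" using A(1) by simp
  have sp0: "sp \<ge> 0" by (simp add: sp_def)
  have "1 * T \<le> A * T" using A(1) by (intro mult_le_mono1) simp
  then have Tp: "T < p" using T(2) by linarith
  have q: "q \<ge> 1/2"
  proof -
    have "(1/2) ^ r \<le> (1/2::real) ^ 1" using r_pos by (intro power_decreasing) auto
    then show ?thesis by (simp add: q_def)
  qed
  have W0: "0 \<le> W" "W \<le> 2 * (real A)\<^sup>2"
  proof -
    show "0 \<le> W" unfolding W_def using q by (intro divide_nonneg_nonneg sum_nonneg damped_reach_bounds) auto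
    have "(\<Sum>a<A. damped_reach (1/2) a) \<le> (\<Sum>a<A. real A)" by (intro sum_mono damped_reach_bounds) auto
    then have "(\<Sum>a<A. damped_reach (1/2) a) \<le> (real A)\<^sup>2" by (simp add: power2_eq_square)
    also have "\<dots> \<le> (2 * (real A)\<^sup>2) * q" using q mult_left_mono[of "1/2" q "2 * (real A)\<^sup>2"] by simp
    finally show "W \<le> 2 * (real A)\<^sup>2" unfolding W_def using q by (simp add: divide_le_eq)
  qed
  have eps: "0 \<le> \<epsilon>" "real p * \<epsilon> \<le> 1"
  proof -
    show "0 \<le> \<epsilon>" by (simp add: \<epsilon>_def)
    have "\<epsilon> \<le> (1/2) ^ T" unfolding \<epsilon>_def using r_pos by (intro power_decreasing) auto
    then have "real p * \<epsilon> \<le> real p * (1/2) ^ T" by (intro mult_left_mono) auto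
    also have "\<dots> = real p / 2 ^ T" by (simp add: power_divide)
    also have "\<dots> \<le> 1"
      using of_nat_mono[OF T(1), where ?'a = real] by simp
    finally show "real p * \<epsilon> \<le> 1" .
  qed
  have count: "\<bar>N h - real p * D h\<bar> \<le> 12 * real A * real h * sp" if "h < p" for h
    using square_free_window_count[OF p A that] unfolding N_def NS_def D_def P_def M_def R_def sp_def .
  have sumD: "(\<Sum>h<H. D h) = W - \<epsilon> * W"
  proof -
    have "q * (\<Sum>h<H. P h a) = (1 - \<epsilon>) * damped_reach (1/2) a" for a
      unfolding q_def \<epsilon>_def P_def H_def by (rule sum_prod_damping)
    then have "(\<Sum>h<H. P h a) = (1 - \<epsilon>) * damped_reach (1/2) a / q" for a
      using q by (simp add: eq_divide_eq mult.commute)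
    moreover have "(\<Sum>h<H. D h) = (\<Sum>a<A. \<Sum>h<H. P h a)" unfolding D_def by (rule sum.swap)
    ultimately have "(\<Sum>h<H. D h) = (\<Sum>a<A. (1 - \<epsilon>) * (damped_reach (1/2) a / q))" by simp
    also have "\<dots> = (1 - \<epsilon>) * W" unfolding W_def by (simp add: sum_distrib_left sum_divide_distrib)
    finally show ?thesis by (simp add: algebra_simps)
  qed
  have main: "\<bar>(\<Sum>h<H. N h) - real p * W\<bar> \<le> 12 * real A * (real H)\<^sup>2 * sp + 2 * (real A)\<^sup>2"
  proof -
    have "\<bar>(\<Sum>h<H. N h) - real p * (\<Sum>h<H. D h)\<bar> = \<bar>\<Sum>h<H. N h - real p * D h\<bar>"
      by (simp add: sum_subtractf sum_distrib_left)
    also have "\<dots> \<le> (\<Sum>h<H. 12 * real A * real H * sp)"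
    proof (intro order_trans[OF sum_abs] sum_mono)
      fix h assume h: "h \<in> {..<H}"
      then have "\<bar>N h - real p * D h\<bar> \<le> 12 * real A * real h * sp" using T(2) by (intro count) (simp add: H_def)
      also have "\<dots> \<le> 12 * real A * real H * sp"
        using h sp0 by (intro mult_right_mono mult_left_mono) auto
      finally show "\<bar>N h - real p * D h\<bar> \<le> 12 * real A * real H * sp" .
    qed
    also have "\<dots> = 12 * real A * (real H)\<^sup>2 * sp" by (simp add: power2_eq_square)
    finally have "\<bar>(\<Sum>h<H. N h) - real p * (W - \<epsilon> * W)\<bar> \<le> 12 * real A * (real H)\<^sup>2 * sp" by (simp add: sumD)
    moreover have "real p * W - real p * (W - \<epsilon> * W) = (real p * \<epsilon>) * W" by (simp add: algebra_simps)
    moreover have "0 \<le> (real p * \<epsilon>) * W" using eps W0 by simp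
    moreover have "(real p * \<epsilon>) * W \<le> 1 * (2 * (real A)\<^sup>2)" using eps W0 by (intro mult_mono) auto
    ultimately show ?thesis by linarith
  qed
  \<comment> \<open>The window \<open>H\<close> consists of \<open>T\<close> full periods, so its
    main term is \<open>p * A * \<epsilon> \<le> A\<close>.\<close>
  have NH: "N H \<le> real A * (1 + 12 * real H * sp)"
  proof -
    have "D H = real A * \<epsilon>"
      using prod_damping_add_period[of "1/2" _ T 0] by (simp add: D_def P_def H_def \<epsilon>_def)
    then have "real p * D H = real A * (real p * \<epsilon>)" by simp
    also have "\<dots> \<le> real A * 1" using eps by (intro mult_left_mono) auto
    finally have "real p * D H \<le> real A" by simp
    moreover have "\<bar>N H - real p * D H\<bar> \<le> 12 * real A * real H * sp"
      using T(2) by (intro count) (simp add: H_def)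
    ultimately show ?thesis by (simp add: algebra_simps)
  qed
  have N0: "N h \<ge> 0" for h by (simp add: N_def)
  \<comment> \<open>\<open>N\<close> is decreasing, since a window without squares contains only
    such windows, and it vanishes from \<open>L\<close> on.\<close>
  have tail: "(\<Sum>h\<in>{H..<M}. N h) \<le> real L * N H"
  proof -
    have "N h \<le> (if h < L then N H else 0)" if "h \<in> {H..<M}" for h
    proof (cases "h < L")
      case True
      have "NS h \<subseteq> NS H" using that by (auto simp: NS_def)
      then have "card (NS h) \<le> card (NS H)" by (intro card_mono) (auto simp: NS_def)
      then show ?thesis using True by (simp add: N_def)
    next
      case False
      then have "NS h = {}"
        unfolding NS_def M_def by (intro nonresidue_gap_bound[OF p A T(1) Tp Q K]) (simp add: L_def)
      then show ?thesis using False by (simp add: N_def)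
    qed
    then have "(\<Sum>h\<in>{H..<M}. N h) \<le> (\<Sum>h\<in>{H..<M}. if h < L then N H else 0)" by (rule sum_mono)
    also have "\<dots> = (\<Sum>h\<in>{h \<in> {H..<M}. h < L}. N H)" by (simp add: sum.If_cases Int_def)
    also have "\<dots> = real (card {h \<in> {H..<M}. h < L}) * N H" by simp
    also have "\<dots> \<le> real L * N H"
    proof (intro mult_right_mono N0)
      have "card {h \<in> {H..<M}. h < L} \<le> card {..<L}" by (intro card_mono) auto
      then show "real (card {h \<in> {H..<M}. h < L}) \<le> real L" by simp
    qed
    finally show ?thesis .
  qed
  have tail': "real L * N H \<le> real A ^ 3 * (2 * real Q * real T + 24 * real Q * (real T)\<^sup>2 * sp)"
  proof -
    have "real L * N H \<le> real L * (real A * (1 + 12 * real H * sp))"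
      by (rule mult_left_mono[OF NH]) simp
    also have "\<dots> = (real A)\<^sup>2 * (2 * real Q * real T) + real A ^ 3 * (24 * real Q * (real T)\<^sup>2 * sp)"
      by (simp add: L_def H_def power2_eq_square power3_eq_cube algebra_simps)
    also have "\<dots> \<le> real A ^ 3 * (2 * real Q * real T) + real A ^ 3 * (24 * real Q * (real T)\<^sup>2 * sp)"
      using A1 by (intro add_right_mono mult_right_mono power_increasing) auto
    finally show ?thesis by (simp add: distrib_left)
  qed
  have main': "12 * real A * (real H)\<^sup>2 * sp + 2 * (real A)\<^sup>2 \<le> real A ^ 3 * (12 * (real T)\<^sup>2 * sp + 2)"
  proof -
    have "(real A)\<^sup>2 \<le> real A ^ 3" using A1 by (intro power_increasing) auto
    moreover have "12 * real A * (real H)\<^sup>2 * sp = real A ^ 3 * (12 * (real T)\<^sup>2 * sp)"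
      by (simp add: H_def power2_eq_square power3_eq_cube algebra_simps)
    moreover have "real A ^ 3 * (12 * (real T)\<^sup>2 * sp + 2) = real A ^ 3 * (12 * (real T)\<^sup>2 * sp) + real A ^ 3 * 2"
      by (rule distrib_left)
    ultimately show ?thesis by linarith
  qed
  have "H \<le> M" using Tp by (simp add: H_def M_def)
  then have split: "(\<Sum>h<M. N h) = (\<Sum>h<H. N h) + (\<Sum>h\<in>{H..<M}. N h)"
    using sum.atLeastLessThan_concat[of 0 H M N] by (simp add: lessThan_atLeast0)
  have M0: "M > 0" using A p by (simp add: M_def)
  have "2 * W - real A = 2 * f_fun A (1/2)"
    using sum_damped_reach_squares_mod[OF A(1)] unfolding W_def q_def R_def .
  then have "2 * f_fun A (1/2) * real p = (2 * W - real A) * real p" by simp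
  also have "\<dots> = 2 * (real p * W) - real M" by (simp add: M_def algebra_simps)
  finally have f: "2 * f_fun A (1/2) * real p = 2 * (real p * W) - real M" .
  have S: "real (gap_square_sum M (squares_mod M)) = 2 * (\<Sum>h<M. N h) - real M"
    using cyclic_set.gap_square_sum_eq[OF cyclic_set_squares_mod[OF M0]] unfolding N_def NS_def .
  have combine: "\<bar>2 * (a + b) - m - (2 * w - m)\<bar> \<le> 2 * E1 + 2 * E2"
    if "\<bar>a - w\<bar> \<le> E1" "0 \<le> b" "b \<le> E2" for a b m w E1 E2 :: real
    using that unfolding abs_le_iff by auto
  have "0 \<le> (\<Sum>h\<in>{H..<M}. N h)" by (intro sum_nonneg N0)
  note combine[OF order_trans[OF main main'] this order_trans[OF tail tail']]
  then have "\<bar>real (gap_square_sum M (squares_mod M)) - 2 * f_fun A (1/2) * real p\<bar> \<le>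
      2 * (real A ^ 3 * (12 * (real T)\<^sup>2 * sp + 2)) +
      2 * (real A ^ 3 * (2 * real Q * real T + 24 * real Q * (real T)\<^sup>2 * sp))"
    unfolding f S split .
  also have "\<dots> = real A ^ 3 * (24 * (real T)\<^sup>2 * sp + 4 + 4 * real Q * real T + 48 * real Q * (real T)\<^sup>2 * sp)"
    by (simp add: algebra_simps)
  finally show ?thesis by (simp add: M_def sp_def)
qed

text \<open>The conditions of \<open>gap_square_sum_estimate\<close> for \<open>T\<close> at most
  \<open>2 ln x + 1\<close>, \<open>Q\<close> near \<open>x^0.42\<close> and \<open>K\<close> near
  \<open>x^0.2\<close>. Then \<open>K\<^sup>2\<close> stays below \<open>Q\<close>, the product
  \<open>K * Q\<close> of order \<open>x^0.62\<close> beats \<open>sqrt x\<close> times a logarithm,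
  \<open>8 * Q\<^sup>2\<close> stays below \<open>x\<close>, and the dominant error
  \<open>Q * T\<^sup>2 * sqrt x\<close> is \<open>x^0.92\<close> up to logarithms, within
  \<open>x^0.95\<close>.\<close>

lemma eventually_parameter_bounds:
  "eventually (\<lambda>x::real. 3 \<le> x \<and> 1 \<le> x powr 0.2 \<and> x powr 0.2 \<le> x powr 0.42 \<and> 8 * (x powr 0.42)\<^sup>2 \<le> x \<and>
     0.1 * x powr 0.1 * (2 * ln x + 1) < x \<and>
     x powr 0.42 - 1 - (x powr 0.2)\<^sup>2 > 0 \<and>
     2 * (1 + 12 * (2 * ln x + 1) * sqrt x) < (x powr 0.2 - 1) * (x powr 0.42 - 1 - (x powr 0.2)\<^sup>2) \<and>
     24 * (2 * ln x + 1)\<^sup>2 * sqrt x + 4 + 4 * x powr 0.42 * (2 * ln x + 1)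
       + 48 * x powr 0.42 * (2 * ln x + 1)\<^sup>2 * sqrt x \<le> x powr 0.95) at_top"
  by (intro eventually_conj; real_asymp)

lemma gap_square_sum_asymptotics:
  obtains p0 :: nat where "\<And>A p. prime p \<Longrightarrow> p \<ge> p0 \<Longrightarrow> 0 < A \<Longrightarrow> real A \<le> 0.1 * real p powr 0.1 \<Longrightarrow>
    coprime A p \<Longrightarrow>
    \<bar>real (gap_square_sum (A * p) (squares_mod (A * p))) - 2 * f_fun A (1/2) * real p\<bar>
      \<le> real A ^ 3 * real p powr 0.95"
proof -
  obtain x0 :: real where x0: "\<And>x. x \<ge> x0 \<Longrightarrow> 3 \<le> x \<and> 1 \<le> x powr 0.2 \<and> x powr 0.2 \<le> x powr 0.42 \<and>
     8 * (x powr 0.42)\<^sup>2 \<le> x \<and> 0.1 * x powr 0.1 * (2 * ln x + 1) < x \<and>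
     x powr 0.42 - 1 - (x powr 0.2)\<^sup>2 > 0 \<and>
     2 * (1 + 12 * (2 * ln x + 1) * sqrt x) < (x powr 0.2 - 1) * (x powr 0.42 - 1 - (x powr 0.2)\<^sup>2) \<and>
     24 * (2 * ln x + 1)\<^sup>2 * sqrt x + 4 + 4 * x powr 0.42 * (2 * ln x + 1)
       + 48 * x powr 0.42 * (2 * ln x + 1)\<^sup>2 * sqrt x \<le> x powr 0.95"
    using eventually_parameter_bounds unfolding eventually_at_top_linorder by blast
  show ?thesis
  proof (rule that[of "nat \<lceil>x0\<rceil>"])
    fix A p :: nat
    assume p: "prime p" "p \<ge> nat \<lceil>x0\<rceil>" and A: "0 < A" "real A \<le> 0.1 * real p powr 0.1" "coprime A p"
    define x where "x = real p"
    have "x \<ge> x0" using p(2) unfolding x_def by linarith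
    note b = x0[OF this]
    define T where "T = nat \<lceil>2 * ln x\<rceil>"
    define Q where "Q = nat \<lfloor>x powr 0.42\<rfloor>"
    define K where "K = nat \<lfloor>x powr 0.2\<rfloor>"
    have lnx: "ln x > 0" using b by (intro ln_gt_zero) linarith
    have T: "2 * ln x \<le> real T" "real T \<le> 2 * ln x + 1" unfolding T_def using lnx by linarith+
    have Q: "real Q \<le> x powr 0.42" "x powr 0.42 - 1 \<le> real Q" unfolding Q_def using b by linarith+
    have K: "real K \<le> x powr 0.2" "x powr 0.2 - 1 \<le> real K" unfolding K_def using b by linarith+
    have pT: "p \<le> 2 ^ T"
    proof -
      \<comment> \<open>\<open>2 * ln 2 \<ge> 1\<close> because \<open>e \<le> 4\<close>, so
        \<open>T \<ge> 2 * ln x\<close> ensures \<open>2 ^ T \<ge> x\<close>.\<close>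
      have "ln (exp 1) \<le> ln (2\<^sup>2 :: real)" using exp_le by (subst ln_le_cancel_iff) auto
      then have "1 \<le> 2 * ln (2 :: real)" using ln_realpow[of 2 2] by simp
      then have "1 * ln x \<le> (2 * ln 2) * ln x" using lnx by (intro mult_right_mono) auto
      also have "\<dots> = (2 * ln x) * ln 2" by simp
      also have "\<dots> \<le> real T * ln 2" using T(1) by (intro mult_right_mono) auto
      also have "\<dots> = ln (2 ^ T)" by (simp add: ln_realpow)
      finally have "ln x \<le> ln (2 ^ T)" by simp
      then have "x \<le> 2 ^ T" using b by (subst (asm) ln_le_cancel_iff) auto
      then show ?thesis unfolding x_def by (metis of_nat_le_iff of_nat_numeral of_nat_power)
    qed
    have AT: "A * T < p"
    proof -
      have "real A * real T \<le> (0.1 * x powr 0.1) * (2 * ln x + 1)"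
        using A(2) T(2) by (intro mult_mono) (auto simp: x_def)
      also have "\<dots> < x" using b by blast
      finally have "real (A * T) < real p" by (simp add: x_def)
      then show ?thesis by (simp only: of_nat_less_iff)
    qed
    have Q0: "0 < Q" unfolding Q_def using b by linarith
    have KQ: "K \<le> Q" unfolding K_def Q_def using b by (intro nat_mono floor_mono) blast
    have Q8: "8 * Q\<^sup>2 \<le> p"
    proof -
      have "(real Q)\<^sup>2 \<le> (x powr 0.42)\<^sup>2" using Q(1) by (intro power_mono) auto
      then have "8 * (real Q)\<^sup>2 \<le> x" using b by linarith
      then have "real (8 * Q\<^sup>2) \<le> real p" by (simp add: x_def)
      then show ?thesis by (simp only: of_nat_le_iff)
    qed
    have strict: "2 * (1 + 12 * real T * sqrt x) < real K * (real Q - (real K)\<^sup>2)"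
    proof -
      have "2 * (1 + 12 * real T * sqrt x) \<le> 2 * (1 + 12 * (2 * ln x + 1) * sqrt x)"
        using T(2) b by (intro mult_left_mono add_left_mono mult_right_mono) auto
      also have "\<dots> < (x powr 0.2 - 1) * (x powr 0.42 - 1 - (x powr 0.2)\<^sup>2)" using b by blast
      also have "\<dots> \<le> real K * (real Q - (real K)\<^sup>2)"
      proof (intro mult_mono)
        have "(real K)\<^sup>2 \<le> (x powr 0.2)\<^sup>2" using K(1) by (intro power_mono) auto
        then show "x powr 0.42 - 1 - (x powr 0.2)\<^sup>2 \<le> real Q - (real K)\<^sup>2" using Q(2) by linarith
      qed (use K(2) b in auto)
      finally show ?thesis .
    qed
    have p2: "p > 2" using b unfolding x_def by simp
    have "\<bar>real (gap_square_sum (A * p) (squares_mod (A * p))) - 2 * f_fun A (1/2) * real p\<bar>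
      \<le> real A ^ 3 * (24 * (real T)\<^sup>2 * sqrt (real p) + 4 + 4 * real Q * real T
                     + 48 * real Q * (real T)\<^sup>2 * sqrt (real p))"
      using strict unfolding x_def by (intro gap_square_sum_estimate[OF p(1) p2 A(1,3) pT AT Q0 KQ Q8])
    also have "\<dots> \<le> real A ^ 3 * (24 * (2 * ln x + 1)\<^sup>2 * sqrt x + 4 + 4 * x powr 0.42 * (2 * ln x + 1)
       + 48 * x powr 0.42 * (2 * ln x + 1)\<^sup>2 * sqrt x)"
      unfolding x_def[symmetric] using T Q lnx b
      by (intro mult_left_mono add_mono mult_mono power_mono order_refl) auto
    also have "\<dots> \<le> real A ^ 3 * x powr 0.95" using b by (intro mult_left_mono) auto
    finally show "\<bar>real (gap_square_sum (A * p) (squares_mod (A * p))) - 2 * f_fun A (1/2) * real p\<bar>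
      \<le> real A ^ 3 * real p powr 0.95" by (simp add: x_def)
  qed
qed

theorem theorem1p3:
  shows "\<exists>C::real. \<forall>(A::nat) (p::nat) (M::nat).
    prime p \<and> 0 < A \<and> squarefree A \<and> real A \<le> 0.1 * real p powr 0.1 \<and> coprime A p \<and> M = A * p \<longrightarrow>
    \<bar>real (gap_square_sum M (squares_mod M)) - 2 * f_fun A 0.5 * real p\<bar>
      \<le> C * (real A ^ 3 * real p powr 0.95)"
proof -
  define err where "err = (\<lambda>(A, p). \<bar>real (gap_square_sum (A * p) (squares_mod (A * p))) - 2 * f_fun A 0.5 * real p\<bar>)"
  obtain p0 :: nat where p0: "\<And>A p. prime p \<Longrightarrow> p \<ge> p0 \<Longrightarrow> 0 < A \<Longrightarrow> real A \<le> 0.1 * real p powr 0.1 \<Longrightarrow>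
      coprime A p \<Longrightarrow> err (A, p) \<le> real A ^ 3 * real p powr 0.95"
    using gap_square_sum_asymptotics unfolding err_def by (auto simp: mult_ac)
  \<comment> \<open>The finitely many pairs with \<open>p < p0\<close> are absorbed into the
    constant: the size condition gives \<open>A \<le> p\<close>, so they lie in \<open>X\<close>,
    and \<open>A ^ 3 * p powr 0.95\<close> is at least 1.\<close>
  define X where "X = {..<p0} \<times> {..<p0}"
  have err0: "err z \<ge> 0" for z by (auto simp: err_def split: prod.splits)
  define C where "C = 1 + (\<Sum>z\<in>X. err z)"
  have C1: "C \<ge> 1" unfolding C_def using err0 by (simp add: sum_nonneg)
  have "err (A, p) \<le> C * (real A ^ 3 * real p powr 0.95)"
    if h: "prime p" "0 < A" "real A \<le> 0.1 * real p powr 0.1" "coprime A p" for A p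
  proof (cases "p \<ge> p0")
    case True
    then have "err (A, p) \<le> 1 * (real A ^ 3 * real p powr 0.95)" using p0 h by simp
    also have "\<dots> \<le> C * (real A ^ 3 * real p powr 0.95)" using C1 by (intro mult_right_mono) auto
    finally show ?thesis .
  next
    case False
    have p1: "real p \<ge> 1" using prime_gt_0_nat[OF h(1)] by simp
    then have "real p powr 0.1 \<le> real p powr 1" by (intro powr_mono) auto
    then have "real A \<le> real p" using h(3) p1 by simp
    then have "(A, p) \<in> X" using False by (simp add: X_def)
    then have "err (A, p) \<le> (\<Sum>z\<in>X. err z)" using err0 by (intro member_le_sum) (auto simp: X_def)
    then have "err (A, p) \<le> C * 1" by (simp add: C_def)
    also have "\<dots> \<le> C * (real A ^ 3 * real p powr 0.95)"
    proof (rule mult_left_mono)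
      have "1 * 1 \<le> real A ^ 3 * real p powr 0.95"
        using h(2) p1 by (intro mult_mono one_le_power ge_one_powr_ge_zero) auto
      then show "1 \<le> real A ^ 3 * real p powr 0.95" by simp
    qed (use C1 in simp)
    finally show ?thesis .
  qed
  then show ?thesis unfolding err_def by (intro exI[of _ C]) auto
qed

end
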